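(* Let $k\ge 2$ be an integer. If $T$ is a tree of order $n$ with $\ell$ leaves, then $$\iota_k(T)= \frac{n+\ell}{2k+1}$$ if and only if $T$ is the $k$-star or $T\in \mathcal{T}_k$.
   Context: Graphs are finite and simple. A leaf is a vertex of degree $1$; the order is the number of vertices. The $k$-star is (a copy of) $K_{1,k}$. For $D\subseteq V(G)$, $N[D]$ is the set consisting of the vertices of $D$ and all their neighbours. A $k$-isolating set of $G$ is a set $D\subseteq V(G)$ (possibly empty) such that $G-N[D]$ contains no subgraph isomorphic to $K_{1,k}$ (equivalently, the maximum degree of $G-N[D]$ is at most $k-1$). The $k$-isolation number $\iota_k(G)$ is the size of a smallest $k$-isolating set of $G$. The family $\mathcal{T}_k$ ($k\ge 2$): a tree $T$ belongs to $\mathcal{T}_k$ if $V(T)=A(T)\cup B(T)\cup C(T)\cup L(T)$ with $A(T),B(T),C(T),L(T)$ pairwise disjoint, such that: (i) $L(T)$ is the set of leaves of $T$, and all their support vertices (the vertices adjacent to a leaf) belong to $C(T)$; (ii) $A(T)$ induces a forest whose components are all non-trivial (each has more than one vertex); (iii) the subgraph of $T$ induced by $A(T)\cup B(T)$ is obtained from the forest induced by $A(T)$ by attaching exactly one leaf to each vertex of $A(T)$; (iv) each $u\in B(T)$ has $\deg_T(u)=2$, with exactly one neighbour in $A(T)$ and another in $C(T)$; (v) each $u\in C(T)$ has $\deg_T(u)=k$, has at least one neighbour in $B(T)$, and each neighbour of $u$ is either in $B(T)$ or in $L(T)$; (vi) $A(T)\cup B(T)\cup C(T)$ induces a tree. 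*)

theory Defs
  imports Complex_Main "Graph_Theory.Graph_Theory"
begin

text \<open>
  A finite simple graph is a \<^locale>\<open>graph\<close> of the Graph\_Theory entry: a finite symmetric
  digraph without loops and parallel arcs, in which an edge \<open>uv\<close> is the pair of
  arcs \<open>u \<rightarrow> v\<close> and \<open>v \<rightarrow> u\<close>.
\<close>

definition nbhd :: "('a, 'b) pre_digraph \<Rightarrow> 'a \<Rightarrow> 'a set" where
  "nbhd G u = {v. u \<rightarrow>\<^bsub>G\<^esub> v}"

definition degree :: "('a, 'b) pre_digraph \<Rightarrow> 'a \<Rightarrow> nat" where
  "degree G u = card (nbhd G u)"

definition closed_nbhd :: "('a, 'b) pre_digraph \<Rightarrow> 'a set \<Rightarrow> 'a set" where
  "closed_nbhd G D = D \<union> (\<Union>u\<in>D. nbhd G u)"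

definition leaves :: "('a, 'b) pre_digraph \<Rightarrow> 'a set" where
  "leaves G = {u \<in> verts G. degree G u = 1}"

text \<open>
  \<^const>\<open>forest\<close> and \<^const>\<open>tree\<close> cannot be used for undirected graphs: they exclude all directed
  cycles, including the closed walk \<open>u \<rightarrow> v \<rightarrow> u\<close> given by any edge of a symmetric digraph.
  The cycles of the undirected graph are the directed cycles of length at least 3.
  As in \<^const>\<open>connected\<close>, a tree has at least one vertex; a forest may be empty.
\<close>

definition undirected_forest :: "('a, 'b) pre_digraph \<Rightarrow> bool" where
  "undirected_forest G \<longleftrightarrow> graph G \<and> \<not> (\<exists>p. pre_digraph.cycle G p \<and> 3 \<le> length p)"

definition undirected_tree :: "('a, 'b) pre_digraph \<Rightarrow> bool" where
  "undirected_tree G \<longleftrightarrow> connected G \<and> undirected_forest G"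

definition isolating_set :: "nat \<Rightarrow> ('a, 'b) pre_digraph \<Rightarrow> 'a set \<Rightarrow> bool" where
  "isolating_set k G D \<longleftrightarrow>
     D \<subseteq> verts G \<and>
     \<not> (\<exists>H. subgraph H (G \<restriction> (verts G - closed_nbhd G D)) \<and> K\<^bsub>1,k\<^esub> H)"

definition isolation_number :: "nat \<Rightarrow> ('a, 'b) pre_digraph \<Rightarrow> nat" where
  "isolation_number k G = (LEAST m. \<exists>D. isolating_set k G D \<and> card D = m)"

text \<open>
  The subgraph of \<open>G\<close> induced by \<open>A \<union> B\<close> arises from the one induced by \<open>A\<close> by attaching
  exactly one leaf \<open>f a\<close> to each vertex \<open>a\<close> of \<open>A\<close>, where \<open>B\<close> consists of the new leaves.
\<close>

definition leaf_attached :: "('a, 'b) pre_digraph \<Rightarrow> 'a set \<Rightarrow> 'a set \<Rightarrow> bool" where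
  "leaf_attached G A B \<longleftrightarrow>
     (\<exists>f. bij_betw f A B \<and>
        arcs_ends (G \<restriction> (A \<union> B)) =
          arcs_ends (G \<restriction> A) \<union> {(a, f a) | a. a \<in> A} \<union> {(f a, a) | a. a \<in> A})"

text \<open>
  The strongly connected components of a symmetric digraph (\<^const>\<open>pre_digraph.sccs\<close>) are the
  components of the undirected graph.
\<close>

definition family_T :: "nat \<Rightarrow> ('a, 'b) pre_digraph set" where
  "family_T k = {T. undirected_tree T \<and>
     (\<exists>A B C L.
        verts T = A \<union> B \<union> C \<union> L \<and>
        A \<inter> B = {} \<and> A \<inter> C = {} \<and> A \<inter> L = {} \<and> B \<inter> C = {} \<and> B \<inter> L = {} \<and> C \<inter> L = {} \<and>
        (L = leaves T \<and> (\<forall>u\<in>L. nbhd T u \<subseteq> C)) \<and>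
        (undirected_forest (T \<restriction> A) \<and>
         (\<forall>H \<in> pre_digraph.sccs (T \<restriction> A). 1 < card (verts H))) \<and>
        leaf_attached T A B \<and>
        (\<forall>u\<in>B. degree T u = 2 \<and> card (nbhd T u \<inter> A) = 1 \<and> card (nbhd T u \<inter> C) = 1) \<and>
        (\<forall>u\<in>C. degree T u = k \<and> nbhd T u \<inter> B \<noteq> {} \<and> nbhd T u \<subseteq> B \<union> L) \<and>
        undirected_tree (T \<restriction> (A \<union> B \<union> C)))}"

end

theory Submission
  imports Defs
begin

text \<open>
  Write \<open>n + \<ell>\<close> as a weight: every vertex counts once and every leaf once more. The proof shows that a
  forest has an isolating set \<open>D\<close> with \<open>(2 k + 1) |D|\<close> at most its weight, and that the forests in which
  this cannot be improved are the disjoint unions of \<open>k\<close>-stars and members of \<open>\<T>\<^sub>k\<close>.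

  Both extremal shapes are captured by one local condition. Give every vertex a role: the classes
  \<open>A\<close>, \<open>B\<close>, \<open>C\<close>, \<open>L\<close> of a member of \<open>\<T>\<^sub>k\<close> become \<open>Core\<close>, \<open>Link\<close>, \<open>Hub\<close>, \<open>Tip\<close>, and the neighbours
  of each vertex are constrained as in \<open>\<T>\<^sub>k\<close>, except that a hub may have tips only. A \<open>k\<close>-star is then a
  hub with its tips. Being local, the condition makes sense for forests and survives the removal and
  addition of components. That the vertices outside \<open>L\<close> induce a tree comes for free in a
  tree, because deleting leaves does not disconnect it.

  A labelled forest with \<open>c\<close> hubs has weight \<open>(2 k + 1) c\<close> (\<open>labelled_weight\<close>), and it needs \<open>c\<close>
  vertices, since a single vertex cannot help to destroy the stars at two different hubs
  (\<open>hubs_le_isolating\<close>). Conversely \<open>c\<close> vertices suffice, one of which can be chosen freely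
  (\<open>labelled_isolating_near\<close>). This freedom is what drives the extremality argument.

  By induction on the vertex set, a forest is either labelled or has an isolating set that is strictly
  better than the bound (\<open>beats_bound_or_extremal\<close>). Root the forest and let \<open>c\<close> be a deepest
  vertex of degree at least \<open>k\<close>, with parent \<open>p\<close> and grandparent \<open>g\<close>. If the branch hanging at some
  vertex \<open>v\<close> has weight at least \<open>2 k + 2\<close> and contains no \<open>k\<close>-star outside the closed neighbourhood of
  \<open>v\<close>, then cutting it off and paying for \<open>v\<close> beats the bound (\<open>branch_cut\<close>). If deleting \<open>v\<close> alone
  destroys all its stars, already weight \<open>2 k + 1\<close> is enough, because then the parent of \<open>v\<close> can serve
  the branch and a labelled remainder at once (\<open>heavy_branch_beats_bound\<close>). Applied at \<open>c\<close>, \<open>p\<close> and \<open>g\<close>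
  this leaves, apart from \<open>k\<close>-star components, a single surviving shape: \<open>c\<close> has \<open>k - 1\<close> leaf children, \<open>p\<close> and \<open>g\<close> have degree 2, and
  the rest is labelled. Such a branch either extends the labelling, with the roles \<open>Core\<close>, \<open>Link\<close>, \<open>Hub\<close>
  for \<open>g\<close>, \<open>p\<close>, \<open>c\<close>, or it again permits saving a vertex (\<open>pendant_branch_dichotomy\<close>).
\<close>

section \<open>Induced subforests and labellings\<close>

text \<open>
  A ranking is, up to a constant, the distance from a root in each component of a forest. It replaces acyclicity in the
  induction: it is inherited by induced subgraphs, and the unique neighbour of smaller rank is the
  parent.
\<close>
definition ranking :: "'a set \<Rightarrow> ('a \<Rightarrow> 'a \<Rightarrow> bool) \<Rightarrow> ('a \<Rightarrow> nat) \<Rightarrow> bool" where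
  "ranking V E d \<longleftrightarrow>
     (\<forall>x\<in>V. \<forall>y\<in>V. E x y \<longrightarrow> d y = Suc (d x) \<or> d x = Suc (d y)) \<and>
     (\<forall>x\<in>V. \<forall>y\<in>V. \<forall>z\<in>V. E x y \<and> E x z \<and> d y < d x \<and> d z < d x \<longrightarrow> y = z)"

text \<open>
  The classes \<open>A\<close>, \<open>B\<close>, \<open>C\<close>, \<open>L\<close> of \<open>\<T>\<^sub>k\<close>, in this order.
\<close>
datatype role = Core | Link | Hub | Tip

text \<open>
  All forests of the induction are induced by subsets \<open>S\<close> of one ambient vertex set \<open>V\<close>. A ranking is
  required for each choice of the root, since the construction of isolating sets in labelled
  forests roots the forest at a prescribed hub.
\<close>
locale rankable =
  fixes V :: "'a set" and E :: "'a \<Rightarrow> 'a \<Rightarrow> bool" and k :: nat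
  assumes finite_V: "finite V"
    and E_sym: "E x y \<Longrightarrow> E y x"
    and two_le_k: "2 \<le> k"
    and ex_ranking: "r \<in> V \<Longrightarrow> \<exists>d. ranking V E d \<and> d r = 0"
begin

definition nbrs :: "'a set \<Rightarrow> 'a \<Rightarrow> 'a set" where
  "nbrs S x = {y \<in> S. E x y}"

text \<open>
  Isolated vertices of \<open>S\<close> are not leaves, so cutting off a branch may also destroy a leaf.
\<close>
definition tips :: "'a set \<Rightarrow> 'a set" where
  "tips S = {x \<in> S. card (nbrs S x) = 1}"

definition star_free :: "'a set \<Rightarrow> bool" where
  "star_free S \<longleftrightarrow> (\<forall>x\<in>S. card (nbrs S x) < k)"

definition dominated :: "'a set \<Rightarrow> 'a set \<Rightarrow> 'a set" where
  "dominated S D = (\<Union>u\<in>D. insert u (nbrs S u))"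

definition isolates :: "'a set \<Rightarrow> 'a set \<Rightarrow> bool" where
  "isolates S D \<longleftrightarrow> D \<subseteq> S \<and> star_free (S - dominated S D)"

text \<open>
  The share of \<open>X\<close> in the number \<open>n + \<ell>\<close> of the forest induced by \<open>S\<close>; leaves are those of \<open>S\<close>, not of \<open>X\<close>.
\<close>
definition weight :: "'a set \<Rightarrow> 'a set \<Rightarrow> nat" where
  "weight S X = card X + card (tips S \<inter> X)"

text \<open>
  In contrast to \<open>\<T>\<^sub>k\<close>, a hub without links is permitted: it forms a \<open>k\<close>-star with its tips.
\<close>
definition role_ok :: "'a set \<Rightarrow> ('a \<Rightarrow> role) \<Rightarrow> 'a \<Rightarrow> bool" where
  "role_ok S f x \<longleftrightarrow> (case f x of
     Core \<Rightarrow> (\<exists>b\<in>nbrs S x. f b = Link \<and> (\<forall>y\<in>nbrs S x. y \<noteq> b \<longrightarrow> f y = Core)) \<and>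
             (\<exists>a\<in>nbrs S x. f a = Core)
   | Link \<Rightarrow> \<exists>a c. nbrs S x = {a, c} \<and> f a = Core \<and> f c = Hub
   | Hub \<Rightarrow> card (nbrs S x) = k \<and> (\<forall>y\<in>nbrs S x. f y = Link \<or> f y = Tip)
   | Tip \<Rightarrow> \<exists>c. nbrs S x = {c} \<and> f c = Hub)"

definition labelled :: "'a set \<Rightarrow> ('a \<Rightarrow> role) \<Rightarrow> bool" where
  "labelled S f \<longleftrightarrow> (\<forall>x\<in>S. role_ok S f x)"

definition hubs :: "'a set \<Rightarrow> ('a \<Rightarrow> role) \<Rightarrow> 'a set" where
  "hubs S f = {x \<in> S. f x = Hub}"

lemma E_irrefl: "x \<in> V \<Longrightarrow> \<not> E x x"
  using ex_ranking unfolding ranking_def by fastforce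

lemma nbrs_sym: "y \<in> nbrs S x \<Longrightarrow> x \<in> S \<Longrightarrow> x \<in> nbrs S y"
  by (auto simp: nbrs_def intro: E_sym)

lemma nbrs_subset: "nbrs S x \<subseteq> S"
  by (auto simp: nbrs_def)

lemma finite_sub: "S \<subseteq> V \<Longrightarrow> finite S"
  using finite_V finite_subset by blast

lemma finite_nbrs: "S \<subseteq> V \<Longrightarrow> finite (nbrs S x)"
  using finite_sub nbrs_subset finite_subset by metis

lemma nbrs_mono: "S \<subseteq> S' \<Longrightarrow> nbrs S x \<subseteq> nbrs S' x"
  by (auto simp: nbrs_def)

lemma labelled_Core:
  assumes "labelled S f" "x \<in> S" "f x = Core"
  shows "\<exists>b\<in>nbrs S x. f b = Link \<and> (\<forall>y\<in>nbrs S x. y \<noteq> b \<longrightarrow> f y = Core)"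
    and "\<exists>a\<in>nbrs S x. f a = Core"
  using assms unfolding labelled_def role_ok_def by fastforce+

lemma labelled_Link:
  assumes "labelled S f" "x \<in> S" "f x = Link"
  shows "\<exists>a c. nbrs S x = {a, c} \<and> f a = Core \<and> f c = Hub"
  using assms unfolding labelled_def role_ok_def by fastforce

lemma labelled_Hub:
  assumes "labelled S f" "x \<in> S" "f x = Hub"
  shows "card (nbrs S x) = k" "y \<in> nbrs S x \<Longrightarrow> f y = Link \<or> f y = Tip"
  using assms unfolding labelled_def role_ok_def by fastforce+

lemma labelled_Tip:
  assumes "labelled S f" "x \<in> S" "f x = Tip"
  shows "\<exists>c. nbrs S x = {c} \<and> f c = Hub"
  using assms unfolding labelled_def role_ok_def by fastforce

text \<open>
  A core has a link and a core as neighbours, a link has two neighbours, and a hub has \<open>k \<ge> 2\<close>.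
\<close>
lemma labelled_tips:
  assumes "labelled S f" "S \<subseteq> V"
  shows "tips S = {x \<in> S. f x = Tip}"
proof -
  have "card (nbrs S x) = 1 \<longleftrightarrow> f x = Tip" if x: "x \<in> S" for x
  proof (cases "f x")
    case Core
    then have "\<not> (\<exists>y. nbrs S x = {y})"
      using labelled_Core[OF assms(1) x Core] by (metis role.distinct(1) singletonD)
    then show ?thesis using Core by (auto simp: card_1_singleton_iff)
  next
    case Link
    then obtain a c where "nbrs S x = {a, c}" "f a = Core" "f c = Hub"
      using labelled_Link[OF assms(1) x Link] by blast
    then show ?thesis using Link by (cases "a = c") auto
  next
    case Hub
    then show ?thesis using labelled_Hub[OF assms(1) x Hub] two_le_k by auto
  next
    case Tip
    then show ?thesis using labelled_Tip[OF assms(1) x Tip] by auto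
  qed
  then show ?thesis by (auto simp: tips_def)
qed

lemma hub_star_disjoint:
  assumes "labelled S f" "h \<in> hubs S f" "h' \<in> hubs S f"
    and "x \<in> insert h (nbrs S h)" "x \<in> insert h' (nbrs S h')"
  shows "h = h'"
proof -
  have S: "h \<in> S" "h' \<in> S" "f h = Hub" "f h' = Hub" using assms by (auto simp: hubs_def)
  show ?thesis
  proof (cases "x = h \<or> x = h'")
    case True
    then show ?thesis
      using assms(4,5) labelled_Hub(2)[OF assms(1)] S by fastforce
  next
    case False
    then have x: "x \<in> nbrs S h" "x \<in> nbrs S h'" using assms by auto
    then have hx: "h \<in> nbrs S x" "h' \<in> nbrs S x" "x \<in> S"
      using S nbrs_sym nbrs_subset by blast+
    have "f x = Link \<or> f x = Tip" using labelled_Hub(2)[OF assms(1)] S x by blast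
    then show ?thesis
      using labelled_Link[OF assms(1) hx(3)] labelled_Tip[OF assms(1) hx(3)] hx S by fastforce
  qed
qed

text \<open>
  Cores and links are matched, and the neighbourhoods of the hubs partition the links and tips. With
  \<open>a\<close> cores, \<open>c\<close> hubs and \<open>t\<close> tips this gives \<open>a + t = k c\<close>, so \<open>n + \<ell> = 2 a + c + 2 t = (2 k + 1) c\<close>.
\<close>
lemma labelled_weight:
  assumes l: "labelled S f" and "S \<subseteq> V"
  shows "(2 * k + 1) * card (hubs S f) = weight S S"
proof -
  have fin: "finite S" using assms finite_sub by blast
  define X where "X r = {x \<in> S. f x = r}" for r
  have finX: "finite (X r)" for r using fin by (auto simp: X_def)
  have S: "S = X Core \<union> X Link \<union> X Hub \<union> X Tip"
    unfolding X_def using role.exhaust by blast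
  have cS: "card S = card (X Core) + card (X Link) + card (X Hub) + card (X Tip)"
  proof -
    have "card (X Core \<union> X Link) = card (X Core) + card (X Link)"
      by (rule card_Un_disjoint) (use finX in \<open>auto simp: X_def\<close>)
    moreover have "card (X Core \<union> X Link \<union> X Hub) = card (X Core \<union> X Link) + card (X Hub)"
      by (rule card_Un_disjoint) (use finX in \<open>auto simp: X_def\<close>)
    moreover have "card (X Core \<union> X Link \<union> X Hub \<union> X Tip) = card (X Core \<union> X Link \<union> X Hub) + card (X Tip)"
      by (rule card_Un_disjoint) (use finX in \<open>auto simp: X_def\<close>)
    ultimately show ?thesis using S by simp
  qed
  have "\<forall>x\<in>X Core. \<exists>b. b \<in> nbrs S x \<and> f b = Link"
    using labelled_Core(1)[OF l] unfolding X_def by blast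
  then obtain \<beta> where \<beta>: "\<And>x. x \<in> X Core \<Longrightarrow> \<beta> x \<in> nbrs S x \<and> f (\<beta> x) = Link"
    by metis
  have "inj_on \<beta> (X Core)"
  proof (rule inj_onI)
    fix x y assume xy: "x \<in> X Core" "y \<in> X Core" "\<beta> x = \<beta> y"
    then have "x \<in> nbrs S (\<beta> x)" "y \<in> nbrs S (\<beta> x)" "\<beta> x \<in> S" "f (\<beta> x) = Link"
      using \<beta> nbrs_sym nbrs_subset unfolding X_def by fastforce+
    then show "x = y" using labelled_Link[OF l, of "\<beta> x"] xy unfolding X_def by fastforce
  qed
  moreover have "\<beta> ` X Core \<subseteq> X Link" using \<beta> nbrs_subset by (fastforce simp: X_def)
  ultimately have le1: "card (X Core) \<le> card (X Link)" using card_inj_on_le finX by blast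
  have "\<forall>x\<in>X Link. \<exists>a. a \<in> nbrs S x \<and> f a = Core"
    using labelled_Link[OF l] unfolding X_def by blast
  then obtain \<alpha> where \<alpha>: "\<And>x. x \<in> X Link \<Longrightarrow> \<alpha> x \<in> nbrs S x \<and> f (\<alpha> x) = Core"
    by metis
  have "inj_on \<alpha> (X Link)"
  proof (rule inj_onI)
    fix x y assume xy: "x \<in> X Link" "y \<in> X Link" "\<alpha> x = \<alpha> y"
    then have "x \<in> nbrs S (\<alpha> x)" "y \<in> nbrs S (\<alpha> x)" "\<alpha> x \<in> S" "f (\<alpha> x) = Core"
      using \<alpha> nbrs_sym nbrs_subset unfolding X_def by fastforce+
    then obtain b where b: "\<forall>z\<in>nbrs S (\<alpha> x). z \<noteq> b \<longrightarrow> f z = Core"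
      using labelled_Core(1)[OF l, of "\<alpha> x"] by blast
    have "f x \<noteq> Core" "f y \<noteq> Core" using xy by (auto simp: X_def)
    then show "x = y" using b \<open>x \<in> nbrs S (\<alpha> x)\<close> \<open>y \<in> nbrs S (\<alpha> x)\<close> by metis
  qed
  moreover have "\<alpha> ` X Link \<subseteq> X Core" using \<alpha> nbrs_subset by (fastforce simp: X_def)
  ultimately have le2: "card (X Link) \<le> card (X Core)" using card_inj_on_le finX by blast
  have "X Link \<union> X Tip = (\<Union>h\<in>X Hub. nbrs S h)"
  proof
    show "X Link \<union> X Tip \<subseteq> (\<Union>h\<in>X Hub. nbrs S h)"
    proof
      fix x assume "x \<in> X Link \<union> X Tip"
      then have x: "x \<in> S" "f x = Link \<or> f x = Tip" by (auto simp: X_def)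
      then obtain c where "c \<in> nbrs S x" "f c = Hub"
        using labelled_Link[OF l x(1)] labelled_Tip[OF l x(1)] by blast
      then show "x \<in> (\<Union>h\<in>X Hub. nbrs S h)"
        using nbrs_sym[of c S x] nbrs_subset[of S x] x unfolding X_def by blast
    qed
    show "(\<Union>h\<in>X Hub. nbrs S h) \<subseteq> X Link \<union> X Tip"
      using labelled_Hub(2)[OF l] nbrs_subset unfolding X_def by blast
  qed
  moreover have "card (\<Union>h\<in>X Hub. nbrs S h) = (\<Sum>h\<in>X Hub. card (nbrs S h))"
  proof (rule card_UN_disjoint[OF finX])
    show "\<forall>i\<in>X Hub. finite (nbrs S i)" using finite_nbrs assms by blast
    show "\<forall>i\<in>X Hub. \<forall>j\<in>X Hub. i \<noteq> j \<longrightarrow> nbrs S i \<inter> nbrs S j = {}"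
      using hub_star_disjoint[OF l] unfolding X_def hubs_def by blast
  qed
  moreover have "(\<Sum>h\<in>X Hub. card (nbrs S h)) = card (X Hub) * k"
    using labelled_Hub(1)[OF l] by (simp add: X_def)
  moreover have "card (X Link \<union> X Tip) = card (X Link) + card (X Tip)"
    by (rule card_Un_disjoint) (use finX in \<open>auto simp: X_def\<close>)
  ultimately have "card (X Link) + card (X Tip) = card (X Hub) * k" by simp
  moreover have "tips S = X Tip" "hubs S f = X Hub"
    using labelled_tips assms by (auto simp: X_def hubs_def)
  moreover have "tips S \<inter> S = tips S" by (auto simp: tips_def)
  ultimately show ?thesis using le1 le2 cS by (simp add: weight_def algebra_simps)
qed

lemma star_free_mono: "star_free S' \<Longrightarrow> S \<subseteq> S' \<Longrightarrow> S' \<subseteq> V \<Longrightarrow> star_free S"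
  unfolding star_free_def
  by (meson card_mono finite_nbrs le_less_trans nbrs_mono subsetD)

text \<open>
  An isolating set must dominate part of the star at each hub. The closed neighbourhood of any vertex
  meets the star of one hub only: the core neighbours of a core belong to no star, and its
  link to one. Hence distinct hubs use distinct vertices of the isolating set.
\<close>
lemma hubs_le_isolating:
  assumes l: "labelled S f" and "S \<subseteq> V" and D: "isolates S D"
  shows "card (hubs S f) \<le> card D"
proof -
  have "\<exists>v\<in>D. insert v (nbrs S v) \<inter> insert h (nbrs S h) \<noteq> {}" if h: "h \<in> hubs S f" for h
  proof (rule ccontr)
    assume "\<not> ?thesis"
    then have "dominated S D \<inter> insert h (nbrs S h) = {}" by (auto simp: dominated_def)
    moreover have "h \<in> S" "f h = Hub" using h by (auto simp: hubs_def)
    ultimately have "h \<in> S - dominated S D" "nbrs (S - dominated S D) h = nbrs S h"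
      unfolding nbrs_def by auto
    moreover have "star_free (S - dominated S D)" using D by (simp add: isolates_def)
    ultimately have "card (nbrs S h) < k" unfolding star_free_def by metis
    then show False using labelled_Hub(1)[OF l] \<open>h \<in> S\<close> \<open>f h = Hub\<close> by simp
  qed
  then obtain g where g: "\<And>h. h \<in> hubs S f \<Longrightarrow>
      g h \<in> D \<and> insert (g h) (nbrs S (g h)) \<inter> insert h (nbrs S h) \<noteq> {}"
    by metis
  have single: "\<exists>h\<in>hubs S f. \<forall>x\<in>insert v (nbrs S v). f x \<noteq> Core \<longrightarrow> x \<in> insert h (nbrs S h)"
    if v: "v \<in> S" for v
  proof -
    have owner: "\<exists>h\<in>hubs S f. b \<in> nbrs S h" if b: "b \<in> S" "f b = Link \<or> f b = Tip" for b
    proof -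
      obtain c where "c \<in> nbrs S b" "f c = Hub"
        using labelled_Link[OF l b(1)] labelled_Tip[OF l b(1)] b by blast
      then show ?thesis using nbrs_sym[of c S b] nbrs_subset[of S b] b unfolding hubs_def by blast
    qed
    show ?thesis
    proof (cases "f v")
      case Core
      then obtain b where b: "b \<in> nbrs S v" "f b = Link" "\<forall>y\<in>nbrs S v. y \<noteq> b \<longrightarrow> f y = Core"
        using labelled_Core(1)[OF l v] by blast
      then obtain h where "h \<in> hubs S f" "b \<in> nbrs S h" using owner nbrs_subset by blast
      then show ?thesis using b Core by auto
    next
      case Link
      then obtain a c where ac: "nbrs S v = {a, c}" "f a = Core" "f c = Hub"
        using labelled_Link[OF l v] by blast
      then have "c \<in> hubs S f" "v \<in> nbrs S c"
        using nbrs_sym[of c S v] nbrs_subset[of S v] v by (auto simp: hubs_def)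
      then show ?thesis using ac Link by (intro bexI[of _ c]) auto
    next
      case Hub
      then show ?thesis using v by (intro bexI[of _ v]) (auto simp: hubs_def)
    next
      case Tip
      then obtain c where ac: "nbrs S v = {c}" "f c = Hub"
        using labelled_Tip[OF l v] by blast
      then have "c \<in> hubs S f" "v \<in> nbrs S c"
        using nbrs_sym[of c S v] nbrs_subset[of S v] v by (auto simp: hubs_def)
      then show ?thesis using ac by (intro bexI[of _ c]) auto
    qed
  qed
  have DS: "D \<subseteq> S" using D by (simp add: isolates_def)
  have noncore: "f x \<noteq> Core" if "x \<in> insert h (nbrs S h)" "h \<in> hubs S f" for x h
    using that labelled_Hub(2)[OF l] by (fastforce simp: hubs_def)
  have "inj_on g (hubs S f)"
  proof (rule inj_onI)
    fix h h' assume hh: "h \<in> hubs S f" "h' \<in> hubs S f" "g h = g h'"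
    obtain h0 where h0: "h0 \<in> hubs S f"
      "\<forall>x\<in>insert (g h) (nbrs S (g h)). f x \<noteq> Core \<longrightarrow> x \<in> insert h0 (nbrs S h0)"
      using single[of "g h"] g[OF hh(1)] DS by blast
    have "h'' = h0" if h'': "h'' \<in> hubs S f" "g h'' = g h" for h''
    proof -
      obtain x where "x \<in> insert (g h) (nbrs S (g h))" "x \<in> insert h'' (nbrs S h'')"
        using g[OF h''(1)] h''(2) by auto
      then show ?thesis using noncore[OF _ h''(1)] h0 hub_star_disjoint[OF l h''(1) h0(1)] by blast
    qed
    then show "h = h'" using hh by metis
  qed
  moreover have "g ` hubs S f \<subseteq> D" using g by blast
  moreover have "finite D" using DS assms(2) finite_sub by (meson finite_subset)
  ultimately show ?thesis using card_inj_on_le by blast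
qed

section \<open>Isolating sets of labelled forests\<close>
lemma ranking_step:
  assumes "ranking V E d" "S \<subseteq> V" "x \<in> S" "y \<in> nbrs S x"
  shows "d y = Suc (d x) \<or> d x = Suc (d y)"
  using assms unfolding ranking_def nbrs_def by blast

lemma ranking_unique:
  assumes "ranking V E d" "S \<subseteq> V" "x \<in> S" "y \<in> nbrs S x" "z \<in> nbrs S x" "d y < d x" "d z < d x"
  shows "y = z"
  using assms unfolding ranking_def nbrs_def by blast

text \<open>
  Root the forest at the hub \<open>c0\<close>. Every other hub \<open>c\<close> contributes one vertex \<open>\<delta> c\<close>: if the path from
  \<open>c\<close> upwards starts with a link and a core, it is that core, otherwise \<open>c\<close> itself. In the first case
  the link above \<open>c\<close> is dominated, so \<open>c\<close> keeps fewer than \<open>k\<close> neighbours. All cores are dominated: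
  a core whose link lies below it is chosen by the hub below that link, and a core whose link lies
  above it has a core neighbour below it, which is chosen for the same reason. Apart from hubs, only
  links and tips of degree at most 1 remain, and \<open>c0\<close> loses \<open>x\<close>.
\<close>
lemma isolating_all_but_one_star:
  assumes l: "labelled S f" and SV: "S \<subseteq> V" and c0: "c0 \<in> hubs S f"
    and x: "x \<in> insert c0 (nbrs S c0)"
  shows "\<exists>D0\<subseteq>S. card D0 < card (hubs S f) \<and> star_free (S - {x} - dominated S D0)"
proof -
  have fin: "finite S" using SV finite_sub by blast
  have c0': "c0 \<in> S" "f c0 = Hub" using c0 by (auto simp: hubs_def)
  obtain d where d: "ranking V E d" "d c0 = 0" using ex_ranking c0' SV by blast
  note step = ranking_step[OF d(1) SV] and uniq = ranking_unique[OF d(1) SV]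
  \<comment> \<open>\<open>P c a\<close>: the path from \<open>c\<close> upwards is \<open>c\<close>, a link, the core \<open>a\<close>.\<close>
  define P where "P c a \<longleftrightarrow> (\<exists>b. b \<in> nbrs S c \<and> f b = Link \<and> a \<in> nbrs S b \<and> f a = Core
     \<and> d a < d b \<and> d b < d c)" for c a
  define \<delta> where "\<delta> c = (if \<exists>a. P c a then SOME a. P c a else c)" for c
  have \<delta>P: "P c (\<delta> c)" if "\<exists>a. P c a" for c
    using someI_ex[OF that] that by (simp add: \<delta>_def)
  define D where "D = \<delta> ` (hubs S f - {c0})"
  have \<delta>S: "\<delta> c \<in> S" if "c \<in> S" for c
  proof (cases "\<exists>a. P c a")
    case True
    then show ?thesis using \<delta>P[OF True] nbrs_subset unfolding P_def by blast
  next
    case False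
    then show ?thesis using that by (simp add: \<delta>_def)
  qed
  then have DS: "D \<subseteq> S" by (auto simp: D_def hubs_def)
  have finh: "finite (hubs S f)" using fin by (simp add: hubs_def)
  have "card D \<le> card (hubs S f - {c0})" unfolding D_def by (rule card_image_le) (use finh in simp)
  also have "\<dots> < card (hubs S f)" using finh c0 by (rule card_Diff1_less)
  finally have cD: "card D < card (hubs S f)" .
  \<comment> \<open>Cores above their link are chosen.\<close>
  have K1: "a \<in> D" if a: "a \<in> S" "f a = Core" and b: "b \<in> nbrs S a" "f b = Link" "d a < d b" for a b
  proof -
    have bS: "b \<in> S" "a \<in> nbrs S b" using b a nbrs_subset[of S a] nbrs_sym[of b S a] by auto
    obtain c where c: "nbrs S b = {a, c}" "f c = Hub"
      using labelled_Link[OF l bS(1) b(2)] bS(2) a(2) by fastforce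
    have cS: "c \<in> S" "b \<in> nbrs S c" using c nbrs_subset[of S b] nbrs_sym[of c S b] bS by auto
    have "a \<noteq> c" using a c by auto
    then have "\<not> d c < d b" using uniq[OF bS(1), of a c] c b(3) by auto
    then have bc: "d b < d c" using step[OF bS(1), of c] c by auto
    then have "c \<noteq> c0" using d by auto
    then have ch: "c \<in> hubs S f - {c0}" using cS c by (simp add: hubs_def)
    have "P c a" unfolding P_def using cS b bS a bc by blast
    then have "P c (\<delta> c)" using \<delta>P by blast
    then obtain b' where b': "b' \<in> nbrs S c" "\<delta> c \<in> nbrs S b'" "f (\<delta> c) = Core" "d b' < d c"
      unfolding P_def by blast
    then have "b' = b" using uniq[OF cS(1)] cS(2) bc by blast
    then have "\<delta> c = a" using b' c by auto
    then show ?thesis using ch unfolding D_def by blast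
  qed
  have K: "a \<in> dominated S D" if a: "a \<in> S" "f a = Core" for a
  proof -
    obtain b where b: "b \<in> nbrs S a" "f b = Link" "\<forall>y\<in>nbrs S a. y \<noteq> b \<longrightarrow> f y = Core"
      using labelled_Core(1)[OF l a] by blast
    show ?thesis
    proof (cases "d a < d b")
      case True
      then show ?thesis using K1[OF a] b unfolding dominated_def by blast
    next
      case False
      then have ba: "d b < d a" using step[OF a(1) b(1)] by auto
      obtain a' where a': "a' \<in> nbrs S a" "f a' = Core" using labelled_Core(2)[OF l a] by blast
      have a'S: "a' \<in> S" "a \<in> nbrs S a'" using a' a nbrs_subset[of S a] nbrs_sym[of a' S a] by auto
      have "a' \<noteq> b" using a' b by auto
      then have "\<not> d a' < d a" using uniq[OF a(1) a'(1) b(1)] ba by blast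
      then have aa': "d a < d a'" using step[OF a(1) a'(1)] by auto
      obtain b' where b': "b' \<in> nbrs S a'" "f b' = Link"
        using labelled_Core(1)[OF l a'S(1) a'(2)] by blast
      have "a \<noteq> b'" using b' a by auto
      then have "\<not> d b' < d a'" using uniq[OF a'S(1) b'(1) a'S(2)] aa' by blast
      then have "d a' < d b'" using step[OF a'S(1) b'(1)] by auto
      then have "a' \<in> D" using K1[OF a'S(1) a'(2) b'] by blast
      then show ?thesis using a'S unfolding dominated_def by blast
    qed
  qed
  let ?R = "S - {x} - dominated S D"
  have "card (nbrs ?R y) < k" if y: "y \<in> ?R" for y
  proof -
    have yS: "y \<in> S" using y by blast
    have single: "card (nbrs ?R y) < k" if "nbrs ?R y \<subseteq> {c}" for c
      using card_mono[OF _ that] two_le_k by simp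
    have smaller: "card (nbrs ?R y) < k" if "f y = Hub" "b \<in> nbrs S y" "b \<notin> ?R" for b
    proof -
      have "nbrs ?R y \<subseteq> nbrs S y" by (rule nbrs_mono) blast
      moreover have "b \<notin> nbrs ?R y" using that(3) nbrs_subset by blast
      ultimately have "nbrs ?R y \<subset> nbrs S y" using that(2) by blast
      then have "card (nbrs ?R y) < card (nbrs S y)" using finite_nbrs[OF SV] psubset_card_mono by blast
      then show ?thesis using labelled_Hub(1)[OF l yS that(1)] by simp
    qed
    show ?thesis
    proof (cases "f y")
      case Core
      then show ?thesis using K y by blast
    next
      case Link
      then obtain a c where "nbrs S y = {a, c}" "f a = Core"
        using labelled_Link[OF l yS] by blast
      moreover have "nbrs ?R y \<subseteq> nbrs S y \<inter> ?R" by (auto simp: nbrs_def)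
      ultimately have "nbrs ?R y \<subseteq> {c}" using K[of a] nbrs_subset[of S y] by auto
      then show ?thesis by (rule single)
    next
      case Tip
      then obtain c where "nbrs S y = {c}" using labelled_Tip[OF l yS] by blast
      then have "nbrs ?R y \<subseteq> {c}" using nbrs_mono[of ?R S y] by blast
      then show ?thesis by (rule single)
    next
      case Hub
      show ?thesis
      proof (cases "y = c0")
        case True
        then have "x \<in> nbrs S y" using x y by auto
        then show ?thesis using smaller[OF Hub] by blast
      next
        case False
        then have yh: "\<delta> y \<in> D" using Hub yS by (auto simp: D_def hubs_def)
        have "y \<notin> D" using y by (auto simp: dominated_def)
        with yh have "\<delta> y \<noteq> y" by metis
        then have "\<exists>a. P y a" unfolding \<delta>_def by meson
        then obtain b where b: "b \<in> nbrs S y" "\<delta> y \<in> nbrs S b" using \<delta>P[of y] unfolding P_def by blast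
        then have "b \<in> nbrs S (\<delta> y)" using nbrs_sym[of "\<delta> y" S b] nbrs_subset[of S y] by blast
        then have "b \<in> dominated S D" using yh by (auto simp: dominated_def)
        then show ?thesis using smaller[OF Hub b(1)] by simp
      qed
    qed
  qed
  then have "star_free ?R" by (simp add: star_free_def)
  then show ?thesis using DS cD by blast
qed

text \<open>
  One vertex less than the number of hubs suffices once \<open>p\<close> or its closed neighbourhood is gone. So an
  optimal isolating set can contain any prescribed vertex \<open>p\<close>; and if \<open>p\<close> is not a core, it is enough
  that \<open>p\<close> is dominated from outside the forest, which leaves one vertex to spend elsewhere. For a
  core \<open>p\<close> the star at the hub next to the link of \<open>p\<close> is the one that is weakened.
\<close>
lemma labelled_isolating_near:
  assumes l: "labelled S f" and SV: "S \<subseteq> V" and p: "p \<in> S"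
  shows "\<exists>D0\<subseteq>S. card D0 < card (hubs S f) \<and> star_free (S - insert p (nbrs S p) - dominated S D0)
    \<and> (f p \<noteq> Core \<longrightarrow> star_free (S - {p} - dominated S D0))"
proof -
  have owner: "\<exists>c\<in>hubs S f. b \<in> insert c (nbrs S c)" if b: "b \<in> S" "f b \<noteq> Core" for b
  proof (cases "f b = Hub")
    case True
    then show ?thesis using b by (auto simp: hubs_def)
  next
    case False
    then have "f b = Link \<or> f b = Tip" using b by (cases "f b") auto
    then obtain c where "c \<in> nbrs S b" "f c = Hub"
      using labelled_Link[OF l b(1)] labelled_Tip[OF l b(1)] b by blast
    then show ?thesis using nbrs_sym[of c S b] nbrs_subset[of S b] b unfolding hubs_def by blast
  qed
  show ?thesis
  proof (cases "f p = Core")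
    case False
    then obtain c where "c \<in> hubs S f" "p \<in> insert c (nbrs S c)" using owner p by blast
    then obtain D where D: "D \<subseteq> S" "card D < card (hubs S f)" "star_free (S - {p} - dominated S D)"
      using isolating_all_but_one_star[OF l SV] by blast
    moreover have "star_free (S - insert p (nbrs S p) - dominated S D)"
      by (rule star_free_mono[OF D(3)]) (use SV in auto)
    ultimately show ?thesis by blast
  next
    case True
    then obtain b where b: "b \<in> nbrs S p" "f b = Link" using labelled_Core(1)[OF l p] by blast
    then obtain c where "c \<in> hubs S f" "b \<in> insert c (nbrs S c)"
      using owner[of b] nbrs_subset by fastforce
    then obtain D where D: "D \<subseteq> S" "card D < card (hubs S f)" "star_free (S - {b} - dominated S D)"
      using isolating_all_but_one_star[OF l SV] by blast
    moreover have "star_free (S - insert p (nbrs S p) - dominated S D)"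
      by (rule star_free_mono[OF D(3)]) (use SV b in auto)
    ultimately show ?thesis using True by blast
  qed
qed

section \<open>Cutting off branches\<close>
definition beats_bound :: "'a set \<Rightarrow> bool" where
  "beats_bound S \<longleftrightarrow> (\<exists>D. isolates S D \<and> (2 * k + 1) * card D < weight S S)"

definition extremal :: "'a set \<Rightarrow> bool" where
  "extremal S \<longleftrightarrow> (\<exists>f. labelled S f)"

text \<open>
  A branch is a part of the forest that is attached by the single edge from \<open>v\<close>, its root, to \<open>q\<close>.
\<close>
definition branch :: "'a set \<Rightarrow> 'a set \<Rightarrow> 'a \<Rightarrow> 'a \<Rightarrow> bool" where
  "branch S X v q \<longleftrightarrow> X \<subseteq> S \<and> v \<in> X \<and> q \<in> S - X \<and> E v q \<and>
     (\<forall>x\<in>X. \<forall>y\<in>S - X. E x y \<longrightarrow> x = v \<and> y = q)"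

definition detached :: "'a set \<Rightarrow> 'a set \<Rightarrow> bool" where
  "detached S X \<longleftrightarrow> X \<subseteq> S \<and> (\<forall>x\<in>X. \<forall>y\<in>S - X. \<not> E x y)"

lemma extremal_empty: "extremal {}"
  by (simp add: extremal_def labelled_def)

lemma star_free_Un:
  assumes "star_free P" "star_free Q" "\<And>x y. x \<in> P \<Longrightarrow> y \<in> Q \<Longrightarrow> \<not> E x y"
  shows "star_free (P \<union> Q)"
proof -
  have "nbrs (P \<union> Q) x = nbrs P x" if "x \<in> P" for x
    using that assms(3) unfolding nbrs_def by blast
  moreover have "nbrs (P \<union> Q) x = nbrs Q x" if "x \<in> Q" for x
    using that assms(3) E_sym unfolding nbrs_def by blast
  ultimately show ?thesis using assms(1,2) unfolding star_free_def by fastforce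
qed

text \<open>
  Isolation is checked piecewise: what \<open>D\<close> leaves over is covered by two star-free sets that are not
  joined by an edge.
\<close>
lemma isolates_glue:
  assumes "S \<subseteq> V" "D \<subseteq> S" "S - dominated S D \<subseteq> P \<union> Q" "P \<union> Q \<subseteq> V" "star_free P" "star_free Q"
    "\<And>x y. x \<in> P \<Longrightarrow> y \<in> Q \<Longrightarrow> \<not> E x y"
  shows "isolates S D"
  unfolding isolates_def
  using star_free_mono[OF star_free_Un[OF assms(5,6,7)] assms(3,4)] assms(2) by blast

lemma dominated_mono: "S \<subseteq> S' \<Longrightarrow> D \<subseteq> D' \<Longrightarrow> dominated S D \<subseteq> dominated S' D'"
  unfolding dominated_def nbrs_def by blast

text \<open>
  In a labelled forest, one vertex \<open>p\<close> together with the set from \<open>labelled_isolating_near\<close> attains the bound.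
\<close>
lemma beats_bound_or_extremal_isolating:
  assumes SV: "S \<subseteq> V" and "beats_bound S \<or> extremal S"
  shows "\<exists>D. isolates S D \<and> (2 * k + 1) * card D \<le> weight S S"
proof (cases "beats_bound S \<or> S = {}")
  case True
  moreover have "isolates {} {}" by (simp add: isolates_def star_free_def)
  ultimately show ?thesis unfolding beats_bound_def by (metis card.empty less_imp_le mult_0_right zero_le)
next
  case False
  then obtain f p where f: "labelled S f" and p: "p \<in> S" using assms unfolding extremal_def by blast
  obtain D where D: "D \<subseteq> S" "card D < card (hubs S f)"
      "star_free (S - insert p (nbrs S p) - dominated S D)"
    using labelled_isolating_near[OF f SV p] by blast
  have "isolates S (insert p D)"
    unfolding isolates_def using D(1) p
    by (auto intro!: star_free_mono[OF D(3)] simp: dominated_def subsetD[OF SV])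
  moreover have "card (insert p D) \<le> card (hubs S f)"
    by (rule card_insert_le_m1) (use D(2) in auto)
  ultimately show ?thesis using labelled_weight[OF f SV] by (metis mult_le_mono2)
qed

lemma detached_weight:
  assumes "detached S X" "S \<subseteq> V"
  shows "weight (S - X) (S - X) + weight S X = weight S S"
proof -
  have X: "X \<subseteq> S" using assms by (simp add: detached_def)
  have fin: "finite S" using assms finite_sub by blast
  have "nbrs (S - X) y = nbrs S y" if y: "y \<in> S - X" for y
  proof -
    have "z \<notin> X" if "E y z" for z
      using E_sym[OF that] y assms(1) unfolding detached_def by blast
    then show ?thesis unfolding nbrs_def by blast
  qed
  then have "tips (S - X) \<inter> (S - X) = tips S \<inter> S - tips S \<inter> X" by (auto simp: tips_def)
  moreover have "card (tips S \<inter> S - tips S \<inter> X) = card (tips S \<inter> S) - card (tips S \<inter> X)"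
    by (rule card_Diff_subset) (use fin X in \<open>auto simp: tips_def intro: finite_subset\<close>)
  moreover have "card (tips S \<inter> X) \<le> card (tips S \<inter> S)"
    by (rule card_mono) (use fin X in auto)
  moreover have "card (S - X) = card S - card X" "card X \<le> card S"
    using fin X by (auto intro: card_Diff_subset card_mono finite_subset)
  ultimately show ?thesis by (simp add: weight_def)
qed

lemma branch_nbrs:
  assumes "branch S X v q"
  shows "y \<in> S - X \<Longrightarrow> nbrs (S - X) y = (if y = q then nbrs S q - {v} else nbrs S y)"
    and "v \<in> nbrs S q"
proof -
  have b: "X \<subseteq> S" "v \<in> X" "q \<in> S - X" "E v q"
    "\<And>x y. x \<in> X \<Longrightarrow> y \<in> S - X \<Longrightarrow> E x y \<Longrightarrow> x = v \<and> y = q"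
    using assms by (auto simp: branch_def)
  show "v \<in> nbrs S q" using b(1,2) E_sym[OF b(4)] by (auto simp: nbrs_def)
  show "nbrs (S - X) y = (if y = q then nbrs S q - {v} else nbrs S y)" if y: "y \<in> S - X"
  proof -
    have "z = v \<and> y = q" if "z \<in> X" "E y z" for z
      using b(5)[OF that(1) y] E_sym[OF that(2)] by blast
    moreover have "v \<notin> S - X" using b(2) by blast
    ultimately have "nbrs (S - X) y = (if y = q then nbrs S y - {v} else nbrs S y)"
      unfolding nbrs_def by (cases "y = q") (simp; blast)+
    then show ?thesis by simp
  qed
qed

text \<open>
  Cutting the branch off changes the degree of \<open>q\<close> only. A new leaf arises if \<open>q\<close> had degree 2, and a
  leaf is lost if \<open>q\<close> had degree 1.
\<close>
lemma branch_weight: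
  assumes br: "branch S X v q" and SV: "S \<subseteq> V"
  shows "weight (S - X) (S - X) + weight S X + (if card (nbrs S q) = 1 then 1 else 0)
       \<le> weight S S + (if card (nbrs S q) = 2 then 1 else 0)"
proof -
  have X: "X \<subseteq> S" and q: "q \<in> S - X" using br by (auto simp: branch_def)
  have fin: "finite S" using SV finite_sub by blast
  note nb = branch_nbrs[OF br]
  have cq: "card (nbrs (S - X) q) = card (nbrs S q) - 1"
    using nb(1)[OF q] nb(2) finite_nbrs[OF SV] by simp
  let ?A = "tips S - X - {q}"
  have "tips (S - X) = ?A \<union> (if card (nbrs S q) = 2 then {q} else {})"
  proof -
    have "card (nbrs (S - X) y) = 1 \<longleftrightarrow> (if y = q then card (nbrs S q) = 2 else card (nbrs S y) = 1)"
      if "y \<in> S - X" for y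
      using nb(1)[OF that] cq by auto
    then show ?thesis using q by (auto simp: tips_def split: if_splits)
  qed
  then have "card (tips (S - X)) = card ?A + (if card (nbrs S q) = 2 then 1 else 0)"
    using fin by (auto simp: tips_def)
  moreover have "card (tips S) = card (tips S \<inter> X) + card ?A + (if card (nbrs S q) = 1 then 1 else 0)"
  proof -
    have "tips S = (tips S \<inter> X) \<union> (?A \<union> (tips S \<inter> {q}))" using q by blast
    moreover have "card ((tips S \<inter> X) \<union> (?A \<union> (tips S \<inter> {q}))) = card (tips S \<inter> X) + card (?A \<union> (tips S \<inter> {q}))"
      by (rule card_Un_disjoint) (use fin q in \<open>auto simp: tips_def\<close>)
    moreover have "card (?A \<union> (tips S \<inter> {q})) = card ?A + card (tips S \<inter> {q})"
      by (rule card_Un_disjoint) (use fin q in \<open>auto simp: tips_def\<close>)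
    moreover have "tips S \<inter> {q} = (if card (nbrs S q) = 1 then {q} else {})"
      using q by (auto simp: tips_def)
    ultimately show ?thesis by auto
  qed
  moreover have "card (S - X) = card S - card X" "card X \<le> card S"
    using fin X by (auto intro: card_Diff_subset card_mono finite_subset)
  moreover have "tips S \<inter> S = tips S" "tips (S - X) \<inter> (S - X) = tips (S - X)" by (auto simp: tips_def)
  ultimately show ?thesis by (simp add: weight_def)
qed

text \<open>
  If \<open>q\<close> has degree 2, it can be cut off together with the branch. The additional unit of weight makes
  up for the leaf that may arise at \<open>h\<close>, so that a branch of weight \<open>w\<close> can always be cut off at
  a gain of at least \<open>w\<close>.
\<close>
lemma branch_extend:
  assumes br: "branch S X v q" and SV: "S \<subseteq> V" and q: "nbrs S q = {v, h}" "h \<noteq> v"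
  shows "branch S (insert q X) q h" "weight S (insert q X) = weight S X + 1"
proof -
  have "h \<in> nbrs S q" using q by blast
  then have h: "h \<in> S" "E q h" "h \<noteq> q" using E_irrefl SV br by (auto simp: nbrs_def branch_def)
  have "h \<notin> X" using h(2) E_sym[OF h(2)] q(2) br unfolding branch_def by auto
  moreover have "x = q \<and> y = h" if "x \<in> insert q X" "y \<in> S - insert q X" "E x y" for x y
  proof (cases "x = q")
    case True
    then have "y \<in> nbrs S q" using that by (auto simp: nbrs_def)
    then show ?thesis using q True that br by (auto simp: branch_def)
  next
    case False
    then show ?thesis using that br unfolding branch_def by blast
  qed
  moreover have "q \<in> S" "X \<subseteq> S" using br by (auto simp: branch_def)
  ultimately show "branch S (insert q X) q h" using h unfolding branch_def by blast
  have "q \<notin> tips S" using q by (simp add: tips_def)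
  moreover have "q \<notin> X" "finite X" using br finite_sub SV unfolding branch_def
    by (auto intro: finite_subset[OF _ finite_V])
  ultimately show "weight S (insert q X) = weight S X + 1" by (simp add: weight_def)
qed

text \<open>
  The root \<open>v\<close> joins the isolating set. It dominates \<open>q\<close> as well, so the set \<open>D\<close> for the remainder has
  to cope only with what is left without \<open>q\<close>.
\<close>
lemma cut_at_root:
  assumes SV: "S \<subseteq> V" and br: "branch S X v q" and sf: "star_free (X - insert v (nbrs S v))"
    and Y: "Y = X \<or> Y = insert q X"
    and D: "D \<subseteq> S - Y" "star_free (S - Y - {q} - dominated (S - Y) D)"
    and c: "(2 * k + 1) * Suc (card D) < weight S S"
  shows "beats_bound S"
proof -
  have b: "X \<subseteq> S" "v \<in> X" "q \<in> S - X" "E v q" using br by (auto simp: branch_def)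
  have q: "q \<in> nbrs S v" using b by (simp add: nbrs_def)
  have "isolates S (insert v D)"
  proof (rule isolates_glue[OF SV])
    show "insert v D \<subseteq> S" using b D by blast
    show "S - dominated S (insert v D) \<subseteq> (X - insert v (nbrs S v)) \<union> (S - Y - {q} - dominated (S - Y) D)"
      using Y q dominated_mono[of "S - Y" S D D] unfolding dominated_def by blast
    show "(X - insert v (nbrs S v)) \<union> (S - Y - {q} - dominated (S - Y) D) \<subseteq> V" using SV b by blast
    show "\<not> E x y" if "x \<in> X - insert v (nbrs S v)" "y \<in> S - Y - {q} - dominated (S - Y) D" for x y
      using that br Y unfolding branch_def by blast
  qed (use sf D in auto)
  moreover have "card (insert v D) \<le> Suc (card D)" by (rule card_insert_le_m1) auto
  then have "(2 * k + 1) * card (insert v D) \<le> (2 * k + 1) * Suc (card D)" by (rule mult_le_mono2)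
  ultimately show ?thesis using c unfolding beats_bound_def by (meson le_less_trans)
qed

text \<open>
  Here \<open>q\<close> joins the isolating set. It dominates the root of the branch and, in the remainder, all
  of \<open>R\<close>.
\<close>
lemma cut_at_parent:
  assumes SV: "S \<subseteq> V" and br: "branch S X v q" and sf: "star_free (X - {v})"
    and Y: "Y = X \<or> Y = insert q X" and R: "R \<subseteq> insert q (nbrs S q)"
    and D: "D \<subseteq> S - Y" "star_free (S - Y - R - dominated (S - Y) D)"
    and c: "(2 * k + 1) * Suc (card D) < weight S S"
  shows "beats_bound S"
proof -
  have b: "X \<subseteq> S" "v \<in> X" "q \<in> S - X" using br by (auto simp: branch_def)
  have v: "v \<in> nbrs S q" using br by (rule branch_nbrs)
  have "isolates S (insert q D)"
  proof (rule isolates_glue[OF SV])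
    show "insert q D \<subseteq> S" using b D by blast
    show "S - dominated S (insert q D) \<subseteq> (X - {v}) \<union> (S - Y - R - dominated (S - Y) D)"
      using Y v R dominated_mono[of "S - Y" S D D] unfolding dominated_def by blast
    show "(X - {v}) \<union> (S - Y - R - dominated (S - Y) D) \<subseteq> V" using SV b by blast
    show "\<not> E x y" if "x \<in> X - {v}" "y \<in> S - Y - R - dominated (S - Y) D" for x y
      using that br Y unfolding branch_def by blast
  qed (use sf D in auto)
  moreover have "card (insert q D) \<le> Suc (card D)" by (rule card_insert_le_m1) auto
  then have "(2 * k + 1) * card (insert q D) \<le> (2 * k + 1) * Suc (card D)" by (rule mult_le_mono2)
  ultimately show ?thesis using c unfolding beats_bound_def by (meson le_less_trans)
qed

text \<open>
  Paying for \<open>v\<close> costs \<open>2 k + 1\<close>, and cutting gains at least the weight of the branch. So the bound is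
  beaten unless this weight is exactly \<open>2 k + 1\<close>, nothing is gained at the attachment, and the remainder is
  extremal. If \<open>q\<close> has degree 1, its loss as a leaf is an extra gain; if \<open>q\<close> has degree 2, it is cut
  off too, and the gain is exact only if its other neighbour \<open>h\<close> turns into a leaf.
\<close>
lemma branch_cut:
  assumes SV: "S \<subseteq> V" and br: "branch S X v q" and sf: "star_free (X - insert v (nbrs S v))"
    and w: "2 * k + 1 \<le> weight S X"
    and IH: "\<And>S'. S' \<subset> S \<Longrightarrow> beats_bound S' \<or> extremal S'"
  shows "beats_bound S \<or> weight S X = 2 * k + 1 \<and>
    (3 \<le> card (nbrs S q) \<and> extremal (S - X) \<or>
     (\<exists>h. nbrs S q = {v, h} \<and> h \<noteq> v \<and> card (nbrs S h) = 2 \<and> extremal (S - insert q X)))"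
proof -
  have b: "X \<subseteq> S" "v \<in> X" "q \<in> S - X" using br by (auto simp: branch_def)
  have v: "v \<in> nbrs S q" using br by (rule branch_nbrs)
  have cut: "beats_bound S" if Y: "Y = X \<or> Y = insert q X" and D: "isolates (S - Y) D"
    and c: "(2 * k + 1) * card D + 2 * k + 1 < weight S S" for Y D
  proof (rule cut_at_root[OF SV br sf Y])
    show "D \<subseteq> S - Y" using D by (simp add: isolates_def)
    have "star_free (S - Y - dominated (S - Y) D)" using D by (simp add: isolates_def)
    then show "star_free (S - Y - {q} - dominated (S - Y) D)"
      by (rule star_free_mono) (use SV in auto)
    show "(2 * k + 1) * Suc (card D) < weight S S" using c by simp
  qed
  note bw = branch_weight[OF br SV]
  have sub: "S - Y \<subset> S" "S - Y \<subseteq> V" if "Y = X \<or> Y = insert q X" for Y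
    using that b SV by blast+
  have key: "beats_bound S" if Y: "Y = X \<or> Y = insert q X"
    and le: "weight (S - Y) (S - Y) + 2 * k + 1 \<le> weight S S"
    and s: "beats_bound (S - Y) \<or> weight (S - Y) (S - Y) + 2 * k + 1 < weight S S" for Y
  proof (cases "beats_bound (S - Y)")
    case True
    then obtain D where "isolates (S - Y) D" "(2 * k + 1) * card D < weight (S - Y) (S - Y)"
      unfolding beats_bound_def by blast
    then show ?thesis using cut[OF Y] le by fastforce
  next
    case False
    obtain D where "isolates (S - Y) D" "(2 * k + 1) * card D \<le> weight (S - Y) (S - Y)"
      using beats_bound_or_extremal_isolating[OF sub(2)[OF Y] IH[OF sub(1)[OF Y]]] by blast
    then show ?thesis using cut[OF Y] s False by fastforce
  qed
  have "card (nbrs S q) \<noteq> 0" using v finite_nbrs[OF SV] by auto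
  then consider "card (nbrs S q) = 1" | "card (nbrs S q) = 2" | "3 \<le> card (nbrs S q)" by linarith
  then show ?thesis
  proof cases
    case 1
    then show ?thesis using key[of X] bw w by simp
  next
    case 3
    then have le: "weight (S - X) (S - X) + weight S X \<le> weight S S" using bw by simp
    have "beats_bound (S - X) \<or> extremal (S - X)" using IH[OF sub(1)] by simp
    then show ?thesis using key[of X] le w 3 by fastforce
  next
    case 2
    then obtain x y where xy: "nbrs S q = {x, y}" "x \<noteq> y" by (auto simp: card_2_iff)
    obtain h where h: "nbrs S q = {v, h}" "h \<noteq> v"
    proof (cases "v = x")
      case True
      then show ?thesis using xy that[of y] by simp
    next
      case False
      then have "nbrs S q = {v, x}" using xy v by auto
      then show ?thesis using False that by simp
    qed
    note ext = branch_extend[OF br SV h]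
    note bw' = branch_weight[OF ext(1) SV]
    let ?Y = "insert q X"
    have le: "weight (S - ?Y) (S - ?Y) + weight S X + 1 \<le> weight S S + (if card (nbrs S h) = 2 then 1 else 0)"
      using bw' ext(2) by linarith
    have "beats_bound (S - ?Y) \<or> extremal (S - ?Y)" using IH[OF sub(1)] by simp
    then show ?thesis using key[of ?Y] le w h by (cases "card (nbrs S h) = 2") fastforce+
  qed
qed

text \<open>
  In the exceptional cases of \<open>branch_cut\<close> the remainder is labelled, and the vertex \<open>q\<close> replaces \<open>v\<close>.
  If \<open>q\<close> stays in the remainder, it takes part in an optimal isolating set there, and \<open>v\<close> is
  dominated at no extra cost. If \<open>q\<close> has been cut off, it dominates the leaf \<open>h\<close> of the remainder;
  as a leaf \<open>h\<close> is not a core, so the remainder needs one vertex less than its number of hubs. Either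
  way the number of hubs of the remainder suffices for the whole forest.
\<close>
lemma heavy_branch_beats_bound:
  assumes SV: "S \<subseteq> V" and br: "branch S X v q" and sf: "star_free (X - {v})"
    and w: "2 * k + 1 \<le> weight S X"
    and IH: "\<And>S'. S' \<subset> S \<Longrightarrow> beats_bound S' \<or> extremal S'"
  shows "beats_bound S"
proof -
  have b: "X \<subseteq> S" "v \<in> X" "q \<in> S - X" using br by (auto simp: branch_def)
  have sf': "star_free (X - insert v (nbrs S v))"
    by (rule star_free_mono[OF sf]) (use b SV in auto)
  note cut = cut_at_parent[OF SV br sf]
  consider "beats_bound S" | "3 \<le> card (nbrs S q)" "extremal (S - X)"
    | h where "nbrs S q = {v, h}" "h \<noteq> v" "card (nbrs S h) = 2" "extremal (S - insert q X)"
    using branch_cut[OF SV br sf' w IH] by blast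
  then show ?thesis
  proof cases
    case 2
    then obtain f where f: "labelled (S - X) f" by (auto simp: extremal_def)
    have SX: "S - X \<subseteq> V" using SV by blast
    obtain D where D: "D \<subseteq> S - X" "card D < card (hubs (S - X) f)"
      "star_free (S - X - insert q (nbrs (S - X) q) - dominated (S - X) D)"
      using labelled_isolating_near[OF f SX b(3)] by blast
    have "(2 * k + 1) * Suc (card D) \<le> (2 * k + 1) * card (hubs (S - X) f)"
      using D(2) by (intro mult_le_mono2) simp
    also have "\<dots> = weight (S - X) (S - X)" by (rule labelled_weight[OF f SX])
    also have "\<dots> < weight S S" using branch_weight[OF br SV] 2 w by simp
    finally show ?thesis
      using cut[of X "insert q (nbrs (S - X) q)" D] D nbrs_mono[of "S - X" S q] by blast
  next
    case 3
    let ?Y = "insert q X"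
    obtain f where f: "labelled (S - ?Y) f" using 3 by (auto simp: extremal_def)
    have SY: "S - ?Y \<subseteq> V" using SV by blast
    note ext = branch_extend[OF br SV 3(1,2)]
    have h: "h \<in> S - ?Y" using ext by (simp add: branch_def)
    have "card (nbrs (S - ?Y) h) = 1"
      using branch_nbrs[OF ext(1)] h 3(3) finite_nbrs[OF SV] by simp
    then have "h \<in> tips (S - ?Y)" using h by (simp add: tips_def)
    then have "f h \<noteq> Core" using labelled_tips[OF f SY] by simp
    then obtain D where D: "D \<subseteq> S - ?Y" "card D < card (hubs (S - ?Y) f)"
      "star_free (S - ?Y - {h} - dominated (S - ?Y) D)"
      using labelled_isolating_near[OF f SY h] by blast
    have "(2 * k + 1) * Suc (card D) \<le> (2 * k + 1) * card (hubs (S - ?Y) f)"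
      using D(2) by (intro mult_le_mono2) simp
    also have "\<dots> = weight (S - ?Y) (S - ?Y)" by (rule labelled_weight[OF f SY])
    also have "\<dots> < weight S S" using branch_weight[OF ext(1) SV] ext(2) 3 w by simp
    finally show ?thesis using cut[of ?Y "{h}" D] D 3(1) by blast
  qed
qed

lemma detached_cut:
  assumes SV: "S \<subseteq> V" and X: "detached S X" "v \<in> X" and sf: "star_free (X - insert v (nbrs S v))"
    and w: "2 * k + 1 \<le> weight S X"
    and IH: "\<And>S'. S' \<subset> S \<Longrightarrow> beats_bound S' \<or> extremal S'"
  shows "beats_bound S \<or> weight S X = 2 * k + 1 \<and> extremal (S - X)"
proof -
  have XS: "X \<subseteq> S" using X by (simp add: detached_def)
  have SX: "S - X \<subset> S" "S - X \<subseteq> V" using XS X(2) SV by blast+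
  have cut: "beats_bound S" if D: "isolates (S - X) D" and c: "(2 * k + 1) * card D + 2 * k + 1 < weight S S" for D
  proof -
    have "isolates S (insert v D)"
    proof (rule isolates_glue[OF SV])
      show "insert v D \<subseteq> S" using XS X D unfolding isolates_def by blast
      show "S - dominated S (insert v D) \<subseteq> (X - insert v (nbrs S v)) \<union> (S - X - dominated (S - X) D)"
        using dominated_mono[of "S - X" S D D] unfolding dominated_def by blast
      show "(X - insert v (nbrs S v)) \<union> (S - X - dominated (S - X) D) \<subseteq> V" using SV XS by blast
      show "star_free (X - insert v (nbrs S v))" by (rule sf)
      show "star_free (S - X - dominated (S - X) D)" using D by (simp add: isolates_def)
      show "\<not> E x y" if "x \<in> X - insert v (nbrs S v)" "y \<in> S - X - dominated (S - X) D" for x y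
        using that X unfolding detached_def by blast
    qed
    moreover have "card (insert v D) \<le> Suc (card D)" by (rule card_insert_le_m1) auto
    then have "(2 * k + 1) * card (insert v D) \<le> (2 * k + 1) * Suc (card D)" by (rule mult_le_mono2)
    then have "(2 * k + 1) * card (insert v D) < weight S S" using c by simp
    ultimately show ?thesis unfolding beats_bound_def by blast
  qed
  note dw = detached_weight[OF X(1) SV]
  show ?thesis
  proof (cases "beats_bound (S - X)")
    case True
    then obtain D where "isolates (S - X) D" "(2 * k + 1) * card D < weight (S - X) (S - X)"
      unfolding beats_bound_def by blast
    then show ?thesis using cut dw w by fastforce
  next
    case False
    then have e: "extremal (S - X)" using IH[OF SX(1)] by blast
    obtain D where "isolates (S - X) D" "(2 * k + 1) * card D \<le> weight (S - X) (S - X)"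
      using beats_bound_or_extremal_isolating[OF SX(2)] e by blast
    then show ?thesis using cut[of D] dw w e by (cases "weight S X = 2 * k + 1") fastforce+
  qed
qed

section \<open>Branches of descendants\<close>
definition kids :: "('a \<Rightarrow> nat) \<Rightarrow> 'a set \<Rightarrow> 'a \<Rightarrow> 'a set" where
  "kids d S v = {y \<in> nbrs S v. d v < d y}"

definition desc :: "('a \<Rightarrow> nat) \<Rightarrow> 'a set \<Rightarrow> 'a \<Rightarrow> 'a set" where
  "desc d S v = {(x, y). x \<in> S \<and> y \<in> kids d S x}\<^sup>* `` {v}"

lemma desc_self: "v \<in> desc d S v"
  by (simp add: desc_def)

lemma desc_kid: "x \<in> desc d S v \<Longrightarrow> x \<in> S \<Longrightarrow> y \<in> kids d S x \<Longrightarrow> y \<in> desc d S v"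
  unfolding desc_def by (auto intro: rtrancl_into_rtrancl)

lemma desc_pred:
  assumes "x \<in> desc d S v" "x \<noteq> v"
  shows "\<exists>y\<in>desc d S v. y \<in> S \<and> x \<in> kids d S y"
proof -
  have "(v, x) \<in> {(x, y). x \<in> S \<and> y \<in> kids d S x}\<^sup>*" using assms by (simp add: desc_def)
  then show ?thesis using assms(2) unfolding desc_def by (cases rule: rtranclE) auto
qed

lemma kids_D: "y \<in> kids d S v \<Longrightarrow> y \<in> nbrs S v \<and> y \<in> S \<and> d v < d y"
  by (auto simp: kids_def nbrs_def)

lemma desc_subset:
  assumes "v \<in> S"
  shows "desc d S v \<subseteq> S"
  using desc_pred kids_D assms by (metis subsetI)

lemma desc_induct [consumes 1, case_names root kid]:
  assumes "x \<in> desc d S v" "P v"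
    "\<And>y z. y \<in> desc d S v \<Longrightarrow> y \<in> S \<Longrightarrow> z \<in> kids d S y \<Longrightarrow> P y \<Longrightarrow> P z"
  shows "P x"
proof -
  have "(v, x) \<in> {(x, y). x \<in> S \<and> y \<in> kids d S x}\<^sup>*" using assms by (simp add: desc_def)
  then show ?thesis
    by (induction rule: rtrancl_induct) (use assms(2,3) in \<open>auto simp: desc_def\<close>)
qed

lemma desc_ge: "x \<in> desc d S v \<Longrightarrow> x = v \<or> d v < d x"
  by (induction rule: desc_induct) (auto dest!: kids_D)

lemma finite_desc: "v \<in> S \<Longrightarrow> S \<subseteq> V \<Longrightarrow> finite (desc d S v)"
  using desc_subset finite_sub finite_subset by metis

context
  fixes d S
  assumes rk: "ranking V E d" and SV: "S \<subseteq> V"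
begin

lemma kids_Suc: "v \<in> S \<Longrightarrow> y \<in> kids d S v \<Longrightarrow> d y = Suc (d v)"
  using ranking_step[OF rk SV, of v y] kids_D[of y d S v] by auto

lemma parent_unique:
  assumes "v \<in> S" "y \<in> kids d S v" "z \<in> nbrs S y" "d z < d y"
  shows "z = v"
  using ranking_unique[OF rk SV _ assms(3) _ assms(4), of v] kids_D[OF assms(2)] nbrs_sym[of y S v] assms(1)
  by simp

text \<open>
  An edge leaving the descendants of \<open>v\<close> must go upwards, and parents of proper descendants are
  descendants.
\<close>
lemma desc_boundary:
  assumes v: "v \<in> S" and x: "x \<in> desc d S v" and y: "y \<in> nbrs S x" "y \<notin> desc d S v"
  shows "x = v \<and> d y < d v"
proof -
  have xS: "x \<in> S" using desc_subset[OF v] x by blast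
  have "\<not> d x < d y" using desc_kid[OF x xS] y by (auto simp: kids_def)
  then have yx: "d y < d x" using ranking_step[OF rk SV xS y(1)] by auto
  have "x = v"
  proof (rule ccontr)
    assume "x \<noteq> v"
    then obtain z where "z \<in> desc d S v" "z \<in> S" "x \<in> kids d S z" using desc_pred[OF x] by blast
    then show False using parent_unique[OF _ _ y(1) yx] y(2) by metis
  qed
  then show ?thesis using yx by simp
qed

lemma branch_desc:
  assumes v: "v \<in> S" and q: "q \<in> nbrs S v" "d q < d v"
  shows "branch S (desc d S v) v q"
  unfolding branch_def
proof (intro conjI ballI impI)
  show "q \<in> S - desc d S v" using desc_ge[of q d S v] q by (auto simp: nbrs_def)
  show "E v q" using q by (simp add: nbrs_def)
  fix x y assume x: "x \<in> desc d S v" and y: "y \<in> S - desc d S v" and e: "E x y"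
  have yx: "y \<in> nbrs S x" using y e by (simp add: nbrs_def)
  then show xv: "x = v" using desc_boundary[OF v x] y by blast
  have "d y < d v" using desc_boundary[OF v x yx] y by blast
  then show "y = q" using ranking_unique[OF rk SV v _ q(1) _ q(2)] yx xv by blast
qed (use desc_subset[OF v] desc_self in auto)

lemma detached_desc:
  assumes v: "v \<in> S" and q: "\<And>q. q \<in> nbrs S v \<Longrightarrow> \<not> d q < d v"
  shows "detached S (desc d S v)"
  unfolding detached_def
proof (intro conjI ballI notI)
  fix x y assume x: "x \<in> desc d S v" and y: "y \<in> S - desc d S v" and e: "E x y"
  have yx: "y \<in> nbrs S x" using y e by (simp add: nbrs_def)
  then show False using desc_boundary[OF v x yx] y q by blast
qed (rule desc_subset[OF v])

lemma desc_unfold: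
  assumes v: "v \<in> S"
  shows "desc d S v = insert v (\<Union>y\<in>kids d S v. desc d S y)"
proof
  show "desc d S v \<subseteq> insert v (\<Union>y\<in>kids d S v. desc d S y)"
  proof
    fix x assume "x \<in> desc d S v"
    then show "x \<in> insert v (\<Union>y\<in>kids d S v. desc d S y)"
      by (induction rule: desc_induct) (auto intro: desc_self desc_kid)
  qed
  have "x \<in> desc d S v" if y: "y \<in> kids d S v" and "x \<in> desc d S y" for x y
    using that(2)
    by (induction rule: desc_induct) (use desc_kid[OF desc_self v y] in \<open>auto intro: desc_kid\<close>)
  then show "insert v (\<Union>y\<in>kids d S v. desc d S y) \<subseteq> desc d S v" using desc_self by auto
qed

text \<open>
  A vertex has only one parent, so following the parents from a common descendant upwards would lead
  to a common vertex with two different parents, or back to \<open>v\<close>.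
\<close>
lemma desc_disjoint:
  assumes v: "v \<in> S" and y: "y \<in> kids d S v" and z: "z \<in> kids d S v" "y \<noteq> z"
  shows "desc d S y \<inter> desc d S z = {}"
proof -
  have vy: "v \<notin> desc d S y" "v \<notin> desc d S z"
    using desc_ge[of v d S y] desc_ge[of v d S z] kids_D[OF y] kids_D[OF z(1)] by auto
  have up: "w = u" if "w \<in> S" "x \<in> kids d S w" "u \<in> S" "x \<in> kids d S u" for w u x
    using parent_unique[OF that(3,4), of w] that nbrs_sym kids_D[OF that(2)] by blast
  have "x \<notin> desc d S z" if "x \<in> desc d S y" for x
    using that
  proof (induction rule: desc_induct)
    case root
    show ?case
    proof
      assume "y \<in> desc d S z"
      then obtain w where "w \<in> desc d S z" "w \<in> S" "y \<in> kids d S w" using desc_pred z(2) by blast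
      then show False using up[OF v y] vy by metis
    qed
  next
    case (kid x x')
    show ?case
    proof
      assume "x' \<in> desc d S z"
      show False
      proof (cases "x' = z")
        case True
        then show False using up[OF kid(2,3) v] z(1) kid(1) vy by metis
      next
        case False
        then obtain w where "w \<in> desc d S z" "w \<in> S" "x' \<in> kids d S w"
          using desc_pred \<open>x' \<in> desc d S z\<close> by blast
        then show False using up[OF kid(2,3)] kid(4) by metis
      qed
    qed
  qed
  then show ?thesis by blast
qed

lemma finite_kids: "finite (kids d S v)"
  using finite_nbrs[OF SV] by (simp add: kids_def)

lemma weight_desc:
  assumes v: "v \<in> S"
  shows "weight S (desc d S v) =
    (if v \<in> tips S then 2 else 1) + (\<Sum>y\<in>kids d S v. weight S (desc d S y))"
proof -
  let ?U = "\<Union>y\<in>kids d S v. desc d S y"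
  have fk: "finite (desc d S y)" if "y \<in> kids d S v" for y
    using finite_desc SV kids_D[OF that] by blast
  have vU: "v \<notin> ?U"
  proof
    assume "v \<in> ?U"
    then obtain y where "y \<in> kids d S v" "v \<in> desc d S y" by blast
    then show False using desc_ge[of v d S y] kids_D[of y d S v] by auto
  qed
  have fU: "finite ?U" using finite_kids fk by blast
  have "card ?U = (\<Sum>y\<in>kids d S v. card (desc d S y))"
    by (rule card_UN_disjoint[OF finite_kids]) (use fk desc_disjoint[OF v] in auto)
  moreover have "card (tips S \<inter> ?U) = (\<Sum>y\<in>kids d S v. card (tips S \<inter> desc d S y))"
  proof -
    have U: "tips S \<inter> ?U = (\<Union>y\<in>kids d S v. tips S \<inter> desc d S y)" by blast
    show ?thesis unfolding U
    proof (rule card_UN_disjoint[OF finite_kids])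
      show "\<forall>i\<in>kids d S v. finite (tips S \<inter> desc d S i)" using fk by blast
      show "\<forall>i\<in>kids d S v. \<forall>j\<in>kids d S v. i \<noteq> j \<longrightarrow>
          (tips S \<inter> desc d S i) \<inter> (tips S \<inter> desc d S j) = {}"
        using desc_disjoint[OF v] by blast
    qed
  qed
  moreover have "card (tips S \<inter> insert v ?U) = card (tips S \<inter> ?U) + (if v \<in> tips S then 1 else 0)"
    using vU fU by auto
  ultimately show ?thesis
    using desc_unfold[OF v] vU fU by (simp add: weight_def sum.distrib)
qed

text \<open>
  A descendant of maximal rank has its parent as only neighbour, so the branch contains a leaf.
\<close>
lemma weight_desc_ge_2:
  assumes y: "y \<in> S" and q: "q \<in> nbrs S y" "d q < d y"
  shows "2 \<le> weight S (desc d S y)"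
    and "weight S (desc d S y) \<le> 2 \<Longrightarrow> desc d S y = {y} \<and> nbrs S y = {q}"
proof -
  have fin: "finite (desc d S y)" using finite_desc y SV by blast
  have "Max (d ` desc d S y) \<in> d ` desc d S y" by (rule Max_in) (use fin desc_self in auto)
  then obtain z where z: "z \<in> desc d S y" "d z = Max (d ` desc d S y)" by auto
  have zS: "z \<in> S" using desc_subset[OF y] z by blast
  have nk: "kids d S z = {}"
  proof (rule ccontr)
    assume "kids d S z \<noteq> {}"
    then obtain u where u: "u \<in> kids d S z" by blast
    then have "u \<in> desc d S y" using desc_kid z zS by blast
    then have "d u \<le> d z" using z fin by simp
    then show False using kids_D[OF u] by simp
  qed
  obtain u where u: "u \<in> nbrs S z" "d u < d z"
  proof (cases "z = y")
    case False
    then obtain u where "u \<in> S" "z \<in> kids d S u" using desc_pred z by blast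
    then show ?thesis using that[of u] kids_D[of z d S u] nbrs_sym by blast
  qed (use q that in blast)
  have "w = u" if "w \<in> nbrs S z" for w
  proof -
    have "\<not> d z < d w" using nk that by (auto simp: kids_def)
    then have "d w < d z" using ranking_step[OF rk SV zS that] by auto
    then show ?thesis using ranking_unique[OF rk SV zS that u(1) _ u(2)] by blast
  qed
  then have nz: "nbrs S z = {u}" using u by blast
  then have zt: "z \<in> tips S \<inter> desc d S y" using zS z by (simp add: tips_def)
  have t: "1 \<le> card (tips S \<inter> desc d S y)"
    using zt fin by (metis One_nat_def Suc_leI card_gt_0_iff empty_iff finite_Int)
  moreover have "1 \<le> card (desc d S y)" using desc_self fin
    by (metis One_nat_def Suc_leI card_gt_0_iff empty_iff)
  ultimately show "2 \<le> weight S (desc d S y)" by (simp add: weight_def)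
  assume "weight S (desc d S y) \<le> 2"
  then have "card (desc d S y) \<le> 1" using t by (simp add: weight_def)
  then have "desc d S y = {y}"
    using desc_self[of y d S] fin by (metis card_le_Suc0_iff_eq One_nat_def empty_iff insertI1 subsetI subset_singletonD)
  then show "desc d S y = {y} \<and> nbrs S y = {q}" using z nz q by auto
qed

lemma kid_weight:
  assumes "v \<in> S" "y \<in> kids d S v"
  shows "2 \<le> weight S (desc d S y)"
    and "weight S (desc d S y) \<le> 2 \<Longrightarrow> desc d S y = {y} \<and> nbrs S y = {v}"
  using weight_desc_ge_2[of y v] kids_D[OF assms(2)] nbrs_sym[of y S v] assms by auto

lemma weight_desc_ge_kids:
  assumes "v \<in> S"
  shows "1 + 2 * card (kids d S v) \<le> weight S (desc d S v)"
proof -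
  have "(\<Sum>y\<in>kids d S v. 2) \<le> (\<Sum>y\<in>kids d S v. weight S (desc d S y))"
    by (rule sum_mono) (use kid_weight[OF assms] in auto)
  then show ?thesis using weight_desc[OF assms] by simp
qed

text \<open>
  Every child contributes at least 2, and exactly 2 only if it is a leaf.
\<close>
lemma weight_desc_eq_kids:
  assumes v: "v \<in> S" and w: "weight S (desc d S v) \<le> 1 + 2 * card (kids d S v)" and y: "y \<in> kids d S v"
  shows "desc d S y = {y} \<and> nbrs S y = {v}"
proof -
  have "(\<Sum>y\<in>kids d S v - {y}. 2) \<le> (\<Sum>y\<in>kids d S v - {y}. weight S (desc d S y))"
    by (rule sum_mono) (use kid_weight[OF v] in auto)
  moreover have "(\<Sum>y\<in>kids d S v. weight S (desc d S y)) =
      weight S (desc d S y) + (\<Sum>y\<in>kids d S v - {y}. weight S (desc d S y))"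
    by (rule sum.remove[OF finite_kids y])
  moreover have "card (kids d S v) = Suc (card (kids d S v - {y}))"
    using finite_kids y by (metis card_Suc_Diff1)
  ultimately have "weight S (desc d S y) \<le> 2" using weight_desc[OF v] w by (auto split: if_splits)
  then show ?thesis using kid_weight(2)[OF v y] by blast
qed

lemma weight_desc_ge_kid:
  assumes v: "v \<in> S" and y: "y \<in> kids d S v"
  shows "(if v \<in> tips S then 2 else 1) + weight S (desc d S y) + (if kids d S v = {y} then 0 else 2)
    \<le> weight S (desc d S v)"
proof -
  have "(\<Sum>z\<in>kids d S v. weight S (desc d S z)) =
      weight S (desc d S y) + (\<Sum>z\<in>kids d S v - {y}. weight S (desc d S z))"
    by (rule sum.remove[OF finite_kids y])
  moreover have "2 \<le> (\<Sum>z\<in>kids d S v - {y}. weight S (desc d S z))" if "kids d S v \<noteq> {y}"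
  proof -
    obtain z where z: "z \<in> kids d S v - {y}" using \<open>kids d S v \<noteq> {y}\<close> y by blast
    have "weight S (desc d S z) \<le> (\<Sum>z\<in>kids d S v - {y}. weight S (desc d S z))"
      by (rule member_le_sum[OF z]) (use finite_kids in auto)
    then show ?thesis using kid_weight(1)[OF v, of z] z by simp
  qed
  ultimately show ?thesis using weight_desc[OF v] by auto
qed

lemma nbrs_kids:
  assumes "v \<in> S" "q \<in> nbrs S v" "d q < d v"
  shows "nbrs S v = insert q (kids d S v)" "q \<notin> kids d S v"
proof -
  have "y \<in> insert q (kids d S v)" if y: "y \<in> nbrs S v" for y
    using ranking_step[OF rk SV assms(1) y] ranking_unique[OF rk SV assms(1) y assms(2) _ assms(3)] y
    by (auto simp: kids_def)
  then show "nbrs S v = insert q (kids d S v)" using assms by (auto simp: kids_def)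
  show "q \<notin> kids d S v" using assms by (auto simp: kids_def)
qed

lemma nbrs_kids_root:
  assumes "v \<in> S" "\<And>q. q \<in> nbrs S v \<Longrightarrow> \<not> d q < d v"
  shows "nbrs S v = kids d S v"
  using ranking_step[OF rk SV assms(1)] assms(2) by (fastforce simp: kids_def)

end

section \<open>Extending a labelling\<close>
lemma role_ok_cong:
  assumes "nbrs S x = nbrs S' x" "\<And>y. y \<in> insert x (nbrs S' x) \<Longrightarrow> f y = f' y"
  shows "role_ok S f x \<longleftrightarrow> role_ok S' f' x"
proof -
  have x: "f x = f' x" using assms(2) by blast
  have "\<And>y. y \<in> nbrs S' x \<Longrightarrow> f y = f' y" using assms(2) by blast
  then show ?thesis unfolding role_ok_def assms(1) x
    by (cases "f' x") (auto; metis insertI1 insertI2)+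
qed

text \<open>
  A \<open>k\<close>-star component is labelled as a hub with tips, independently of the rest.
\<close>
lemma star_component_extremal:
  assumes SV: "S \<subseteq> V" and c: "c \<in> S" "card (nbrs S c) = k"
    and y: "\<And>y. y \<in> nbrs S c \<Longrightarrow> nbrs S y = {c}"
    and X: "X = insert c (nbrs S c)" and ext: "extremal (S - X)"
  shows "extremal S"
proof -
  obtain f where f: "labelled (S - X) f" using ext by (auto simp: extremal_def)
  define f' where "f' x = (if x = c then Hub else if x \<in> nbrs S c then Tip else f x)" for x
  have cc: "c \<notin> nbrs S c" using E_irrefl c SV by (auto simp: nbrs_def)
  have "role_ok S f' x" if x: "x \<in> S" for x
  proof -
    consider "x = c" | "x \<in> nbrs S c" | "x \<in> S - X" using x X by blast
    then show ?thesis
    proof cases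
      case 1
      then show ?thesis using c cc by (auto simp: role_ok_def f'_def)
    next
      case 2
      then have "x \<noteq> c" using cc by auto
      then show ?thesis using 2 y[OF 2] by (simp add: role_ok_def f'_def)
    next
      case 3
      have "z \<notin> X" if "z \<in> nbrs S x" for z
      proof
        assume "z \<in> X"
        moreover have "x \<in> nbrs S z" using nbrs_sym[OF that x] .
        ultimately show False using X y[of z] 3 by auto
      qed
      then have "nbrs S x = nbrs (S - X) x" by (auto simp: nbrs_def)
      moreover have "f' z = f z" if "z \<in> insert x (nbrs (S - X) x)" for z
      proof -
        have "z \<notin> X" using that 3 nbrs_subset by blast
        then show ?thesis using X by (auto simp: f'_def)
      qed
      ultimately have "role_ok S f' x \<longleftrightarrow> role_ok (S - X) f x" by (rule role_ok_cong)
      then show ?thesis using f 3 by (simp add: labelled_def)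
    qed
  qed
  then show ?thesis unfolding extremal_def labelled_def by blast
qed

text \<open>
  The branch that survives all cuts: a star at \<open>c\<close> with \<open>k - 1\<close> leaves \<open>Q\<close>, joined to \<open>h\<close> by the path
  \<open>c\<close>, \<open>p\<close>, \<open>g\<close>. Its weight is \<open>2 k + 1\<close>, the amount by which an additional hub increases the weight.
\<close>
definition pendant :: "'a set \<Rightarrow> 'a set \<Rightarrow> 'a \<Rightarrow> 'a \<Rightarrow> bool" where
  "pendant S X g h \<longleftrightarrow> (\<exists>p c Q. X = {g, p, c} \<union> Q \<and> distinct [g, p, c] \<and> Q \<inter> {g, p, c} = {} \<and>
     nbrs S g = {h, p} \<and> nbrs S p = {g, c} \<and> nbrs S c = insert p Q \<and> card (nbrs S c) = k \<and>
     (\<forall>y\<in>Q. nbrs S y = {c}))"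

text \<open>
  The intended roles are \<open>Tip\<close> on \<open>Q\<close>, and \<open>Hub\<close>, \<open>Link\<close>, \<open>Core\<close> on \<open>c\<close>, \<open>p\<close>, \<open>g\<close>. They fit
  as soon as the attachment vertex \<open>h\<close> is a core.
\<close>
lemma pendant_roles:
  assumes "pendant S X g h" "h \<notin> X" "f h = Core"
  shows "\<exists>f'. (\<forall>x. x \<notin> X \<longrightarrow> f' x = f x) \<and> f' g = Core \<and> (\<forall>x\<in>X. role_ok S f' x)"
proof -
  obtain p c Q where q: "X = {g, p, c} \<union> Q" "distinct [g, p, c]" "Q \<inter> {g, p, c} = {}"
    "nbrs S g = {h, p}" "nbrs S p = {g, c}" "nbrs S c = insert p Q" "card (nbrs S c) = k"
    "\<forall>y\<in>Q. nbrs S y = {c}"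
    using assms(1) unfolding pendant_def by blast
  define f' where "f' x = (if x = g then Core else if x = p then Link else if x = c then Hub
    else if x \<in> Q then Tip else f x)" for x
  have v: "f' g = Core" "f' p = Link" "f' c = Hub" "\<And>y. y \<in> Q \<Longrightarrow> f' y = Tip" "f' h = Core"
    using q assms by (auto simp: f'_def)
  have "role_ok S f' g" "role_ok S f' p" "role_ok S f' c"
    using v q(4-7) by (auto simp: role_ok_def)
  moreover have "role_ok S f' y" if "y \<in> Q" for y
    using v(3,4) q(8) that by (auto simp: role_ok_def)
  ultimately have "\<forall>x\<in>X. role_ok S f' x" using q(1) by blast
  moreover have "\<forall>x. x \<notin> X \<longrightarrow> f' x = f x" using q(1) by (auto simp: f'_def)
  ultimately show ?thesis using v(1) by blast
qed

lemma attach_pendant_to_core: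
  assumes br: "branch S X g h" and pn: "pendant S X g h" and f: "labelled (S - X) f" "f h = Core"
  shows "extremal S"
proof -
  have b: "X \<subseteq> S" "g \<in> X" "h \<in> S - X" using br by (auto simp: branch_def)
  obtain f' where f': "\<And>x. x \<notin> X \<Longrightarrow> f' x = f x" "f' g = Core" "\<forall>x\<in>X. role_ok S f' x"
    using pendant_roles[where f = f, OF pn _ f(2)] b by blast
  have off: "f' z = f z" if "z \<in> insert x (nbrs (S - X) x)" "x \<in> S - X" for x z
    using that nbrs_subset f'(1) by blast
  have "role_ok S f' x" if x: "x \<in> S - X" for x
  proof (cases "x = h")
    case False
    then have "nbrs S x = nbrs (S - X) x" using branch_nbrs(1)[OF br x] by simp
    then have "role_ok S f' x \<longleftrightarrow> role_ok (S - X) f x" by (rule role_ok_cong) (use off x in blast)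
    then show ?thesis using f x by (simp add: labelled_def)
  next
    case True
    have nh: "nbrs S h = insert g (nbrs (S - X) h)"
      using branch_nbrs(1)[OF br b(3)] branch_nbrs(2)[OF br] by auto
    obtain b where b': "b \<in> nbrs (S - X) h" "f b = Link" "\<forall>y\<in>nbrs (S - X) h. y \<noteq> b \<longrightarrow> f y = Core"
      using labelled_Core(1)[OF f(1) b(3) f(2)] by blast
    obtain a where "a \<in> nbrs (S - X) h" "f a = Core"
      using labelled_Core(2)[OF f(1) b(3) f(2)] by blast
    moreover have "f' y = f y" if "y \<in> insert h (nbrs (S - X) h)" for y using off that b(3) by blast
    ultimately have "role_ok S f' h" unfolding role_ok_def nh using b' f f'(2) by auto
    then show ?thesis using True by simp
  qed
  then have "labelled S f'" using f'(3) unfolding labelled_def by blast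
  then show ?thesis by (auto simp: extremal_def)
qed

text \<open>
  The remainder without \<open>h\<close> is labelled, with \<open>i\<close> as a leaf and hence as a tip. In \<open>S\<close> the vertex \<open>i\<close>
  becomes the link between its hub \<open>j\<close> and the new core \<open>h\<close>, and \<open>g\<close>, \<open>h\<close> form a component of cores.
\<close>
lemma attach_pendant_to_tip:
  assumes SV: "S \<subseteq> V" and br: "branch S X g h" and pn: "pendant S X g h"
    and h: "nbrs S h = {g, i}" "i \<noteq> g" "card (nbrs S i) = 2"
    and f: "labelled (S - insert h X) f"
  shows "extremal S"
proof -
  let ?Y = "insert h X"
  have b: "X \<subseteq> S" "g \<in> X" "h \<in> S - X" using br by (auto simp: branch_def)
  note ext = branch_extend(1)[OF br SV h(1,2)]
  have i: "i \<in> S - ?Y" using ext by (simp add: branch_def)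
  have "card (nbrs (S - ?Y) i) = 1"
    using branch_nbrs[OF ext] i h(3) finite_nbrs[OF SV] by simp
  then have "i \<in> tips (S - ?Y)" using i by (simp add: tips_def)
  then have fi: "f i = Tip" using labelled_tips[OF f] SV by auto
  obtain j where j: "nbrs (S - ?Y) i = {j}" "f j = Hub" using labelled_Tip[OF f i fi] by blast
  have jS: "j \<in> S - ?Y" using j nbrs_subset[of "S - ?Y" i] by blast
  define f0 where "f0 = f(h := Core, i := Link)"
  have f0h: "f0 h = Core" using i by (auto simp: f0_def)
  obtain f' where f': "\<And>x. x \<notin> X \<Longrightarrow> f' x = f0 x" "f' g = Core" "\<forall>x\<in>X. role_ok S f' x"
    using pendant_roles[where f = f0, OF pn _ f0h] b by blast
  have v: "f' h = Core" "f' i = Link" "f' j = Hub" "f' g = Core"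
    using f' f0h b i j jS fi by (auto simp: f0_def)
  have off: "f' z = f z" if "z \<in> S - ?Y" "z \<noteq> i" for z using f'(1) that by (simp add: f0_def)
  have "role_ok S f' x" if x: "x \<in> S - ?Y" for x
  proof (cases "x = i")
    case True
    have "nbrs S i = {h, j}"
      using branch_nbrs(1)[OF ext i] branch_nbrs(2)[OF ext] j by auto
    then show ?thesis using True v by (auto simp: role_ok_def)
  next
    case False
    then have nx: "nbrs S x = nbrs (S - ?Y) x" using branch_nbrs(1)[OF ext x] by simp
    show ?thesis
    proof (cases "i \<in> nbrs S x")
      case True
      then have "x \<in> nbrs (S - ?Y) i" using nbrs_sym[of i "S - ?Y" x] nx x by simp
      then have xj: "x = j" using j by simp
      have "f' y = Link \<or> f' y = Tip" if "y \<in> nbrs (S - ?Y) j" for y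
      proof -
        have "y \<in> S - ?Y" using that nbrs_subset[of "S - ?Y" j] by blast
        then show ?thesis
          using labelled_Hub(2)[OF f jS j(2) that] off[of y] v by (cases "y = i") auto
      qed
      then show ?thesis using labelled_Hub(1)[OF f jS j(2)] v nx xj by (simp add: role_ok_def)
    next
      case False
      have "role_ok S f' x \<longleftrightarrow> role_ok (S - ?Y) f x"
        by (rule role_ok_cong[OF nx])
          (use off x False nx \<open>x \<noteq> i\<close> nbrs_subset[of "S - ?Y" x] in auto)
      then show ?thesis using f x by (simp add: labelled_def)
    qed
  qed
  moreover have "role_ok S f' h" using h v by (auto simp: role_ok_def)
  ultimately have "labelled S f'" using f'(3) unfolding labelled_def by blast
  then show ?thesis by (auto simp: extremal_def)
qed

text \<open>
  If \<open>h\<close> has degree at least 3 and is not a core of the labelled remainder, then \<open>g\<close> dominates \<open>h\<close>,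
  so the remainder needs one vertex less than its number of hubs; with \<open>g\<close> itself this count beats the
  bound. In all other exceptional cases of \<open>branch_cut\<close> the labelling extends.
\<close>
lemma pendant_branch_dichotomy:
  assumes SV: "S \<subseteq> V" and br: "branch S X g h" and pn: "pendant S X g h"
    and sf: "star_free (X - insert g (nbrs S g))"
    and w: "2 * k + 1 \<le> weight S X"
    and IH: "\<And>S'. S' \<subset> S \<Longrightarrow> beats_bound S' \<or> extremal S'"
  shows "beats_bound S \<or> extremal S"
proof -
  have b: "X \<subseteq> S" "g \<in> X" "h \<in> S - X" using br by (auto simp: branch_def)
  consider "beats_bound S" | "3 \<le> card (nbrs S h)" "extremal (S - X)"
    | i where "nbrs S h = {g, i}" "i \<noteq> g" "card (nbrs S i) = 2" "extremal (S - insert h X)"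
    using branch_cut[OF SV br sf w IH] by blast
  then show ?thesis
  proof cases
    case 2
    then obtain f where f: "labelled (S - X) f" by (auto simp: extremal_def)
    have SX: "S - X \<subseteq> V" using SV by blast
    show ?thesis
    proof (cases "f h = Core")
      case True
      then show ?thesis using attach_pendant_to_core[OF br pn f] by blast
    next
      case False
      then obtain D where D: "D \<subseteq> S - X" "card D < card (hubs (S - X) f)"
        "star_free (S - X - {h} - dominated (S - X) D)"
        using labelled_isolating_near[OF f SX b(3)] by blast
      have "(2 * k + 1) * Suc (card D) \<le> (2 * k + 1) * card (hubs (S - X) f)"
        using D(2) by (intro mult_le_mono2) simp
      also have "\<dots> = weight (S - X) (S - X)" by (rule labelled_weight[OF f SX])
      also have "\<dots> < weight S S" using branch_weight[OF br SV] 2 w by simp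
      finally have "beats_bound S" using cut_at_root[OF SV br sf _ D(1,3)] by blast
      then show ?thesis by blast
    qed
  next
    case 3
    then show ?thesis using attach_pendant_to_tip[OF SV br pn 3(1-3)] by (auto simp: extremal_def)
  qed blast
qed

section \<open>The extremal forests\<close>

text \<open>
  A deepest vertex \<open>c\<close> of degree at least \<open>k\<close> is fixed, and the branches at \<open>c\<close>, at its parent \<open>p\<close> and
  at its grandparent \<open>g\<close> are cut one after the other. If one of these vertices is a root, the whole
  component is cut off instead, which leaves only a \<open>k\<close>-star as an exceptional case.
\<close>
lemma beats_bound_or_extremal:
  assumes "S \<subseteq> V"
  shows "beats_bound S \<or> extremal S"
  using finite_sub[OF assms] assms
proof (induction S rule: finite_psubset_induct)
  case (psubset S)
  have SV: "S \<subseteq> V" and fin: "finite S" using psubset by auto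
  have IH: "beats_bound S' \<or> extremal S'" if "S' \<subset> S" for S' using psubset that by blast
  show ?case
  proof (cases "\<exists>x\<in>S. k \<le> card (nbrs S x)")
    case False
    then have i: "isolates S {}" by (auto simp: isolates_def star_free_def dominated_def)
    show ?thesis
    proof (cases "S = {}")
      case True
      then show ?thesis using extremal_empty by simp
    next
      case False
      then have "0 < card S" using fin by (simp add: card_gt_0_iff)
      then have "beats_bound S" unfolding beats_bound_def
        by (intro exI[of _ "{}"]) (use i in \<open>simp add: weight_def\<close>)
      then show ?thesis by blast
    qed
  next
    case True
    let ?B = "{x \<in> S. k \<le> card (nbrs S x)}"
    from True SV obtain r where "r \<in> V" by blast
    then obtain d where rk: "ranking V E d" using ex_ranking by blast
    have "Max (d ` ?B) \<in> d ` ?B" by (rule Max_in) (use fin True in auto)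
    then obtain c where c: "c \<in> S" "k \<le> card (nbrs S c)" "d c = Max (d ` ?B)" by auto
    have deepest: "d x \<le> d c" if "x \<in> S" "k \<le> card (nbrs S x)" for x
      using c(3) fin that by simp
    show ?thesis
    proof (rule ccontr)
      assume contra: "\<not> ?thesis"
      let ?X = "desc d S"
      note heavy = heavy_branch_beats_bound[OF SV _ _ _ IH] and root = detached_cut[OF SV _ desc_self _ _ IH]
      have sub: "?X v \<subseteq> V" if "v \<in> S" for v using desc_subset that SV by blast
      \<comment> \<open>Below the level of \<open>c\<close> all degrees are less than \<open>k\<close>, so the level of \<open>c\<close> admits the strong cut.\<close>
      have deep: "star_free (?X v - {v})" if v: "v \<in> S" "d v = d c" for v
        unfolding star_free_def
      proof
        fix x assume x: "x \<in> ?X v - {v}"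
        then have "x \<in> S" "d c < d x" using desc_subset[OF v(1), of d] desc_ge[of x d S v] v(2) by auto
        then have "card (nbrs S x) < k" using deepest by fastforce
        moreover have "card (nbrs (?X v - {v}) x) \<le> card (nbrs S x)"
          by (rule card_mono[OF finite_nbrs[OF SV] nbrs_mono]) (use desc_subset v in blast)
        ultimately show "card (nbrs (?X v - {v}) x) < k" by simp
      qed
      have deep': "star_free (?X v - insert v (nbrs S v))" if v: "v \<in> S" "d v = d c" for v
        by (rule star_free_mono[OF deep[OF v]]) (use sub v in auto)
      have light: "weight S (?X v) \<le> 2 * k" if v: "v \<in> S" "d v = d c" "q \<in> nbrs S v" "d q < d v" for v q
        using heavy[OF branch_desc[OF rk SV v(1,3,4)] deep[OF v(1,2)]] contra by fastforce
      have few: "card (kids d S v) \<le> k - 1" "card (nbrs S v) \<le> k"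
        if v: "v \<in> S" "d v = d c" "q \<in> nbrs S v" "d q < d v" for v q
      proof -
        show "card (kids d S v) \<le> k - 1"
          using weight_desc_ge_kids[OF rk SV v(1)] light[OF v] two_le_k by simp
        then show "card (nbrs S v) \<le> k"
          using nbrs_kids[OF rk SV v(1,3,4)] finite_kids[OF rk SV] two_le_k by simp
      qed
      show False
      proof (cases "\<exists>p\<in>nbrs S c. d p < d c")
        case False
        then have np: "\<not> d q < d c" if "q \<in> nbrs S c" for q using that by blast
        have nk: "nbrs S c = kids d S c" using nbrs_kids_root[OF rk SV c(1)] np by blast
        have w: "1 + 2 * card (nbrs S c) \<le> weight S (?X c)"
          using weight_desc_ge_kids[OF rk SV c(1)] nk by simp
        \<comment> \<open>The component has weight exactly \<open>2 k + 1\<close>, which forces \<open>k\<close> children, all of them leaves.\<close>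
        then have "weight S (?X c) = 2 * k + 1" and ext: "extremal (S - ?X c)"
          using root[OF detached_desc[OF rk SV c(1) np] deep'[OF c(1) refl]] contra c(2) by auto
        then have ck: "card (nbrs S c) = k" and le: "weight S (?X c) \<le> 1 + 2 * card (kids d S c)"
          using w c(2) nk by auto
        have y: "desc d S y = {y} \<and> nbrs S y = {c}" if "y \<in> nbrs S c" for y
          using weight_desc_eq_kids[OF rk SV c(1) le] that nk by blast
        have "?X c = insert c (nbrs S c)"
          using desc_unfold[OF rk SV c(1)] nk y by auto
        then have "extremal S"
          using star_component_extremal[OF SV c(1) ck] y ext by blast
        then show False using contra by blast
      next
        case True
        then obtain p where p: "p \<in> nbrs S c" "d p < d c" by blast
        have pS: "p \<in> S" using p nbrs_subset by blast
        have cp: "c \<in> kids d S p" using p nbrs_sym[OF p(1) c(1)] by (simp add: kids_def)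
        then have dp: "d c = Suc (d p)" using kids_Suc[OF rk SV pS] by blast
        note nc = nbrs_kids[OF rk SV c(1) p]
        have ck: "card (kids d S c) = k - 1" "card (nbrs S c) = k"
          using few[OF c(1) refl p] c(2) nc finite_kids[OF rk SV] by auto
        have wc: "2 * k - 1 \<le> weight S (?X c)"
          using weight_desc_ge_kids[OF rk SV c(1)] ck two_le_k by simp
        have tips_c: "?X y = {y} \<and> nbrs S y = {c}"
          if "weight S (?X c) \<le> 2 * k - 1" "y \<in> kids d S c" for y
          using weight_desc_eq_kids[OF rk SV c(1) _ that(2)] that(1) ck(1) two_le_k by simp
        have Xc: "?X c = insert c (kids d S c)" if "weight S (?X c) \<le> 2 * k - 1"
          using desc_unfold[OF rk SV c(1)] tips_c[OF that] by auto
        \<comment> \<open>At the level of \<open>c\<close> degrees are at most \<open>k\<close>, so a vertex there is harmless once its parent is gone.\<close>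
        have reduced: "card (nbrs R x) < k"
          if x: "x \<in> S" "d c \<le> d x" and R: "R \<subseteq> S" and u: "u \<in> nbrs S x" "u \<notin> R" "d u < d x" for R x u
        proof (cases "d x = d c")
          case True
          have "nbrs R x \<subseteq> nbrs S x" by (rule nbrs_mono[OF R])
          moreover have "u \<notin> nbrs R x" using u(2) nbrs_subset by blast
          ultimately have "nbrs R x \<subset> nbrs S x" using u(1) by blast
          then have "card (nbrs R x) < card (nbrs S x)"
            using psubset_card_mono finite_nbrs[OF SV] by blast
          then show ?thesis using few(2)[OF x(1) True u(1,3)] by simp
        next
          case False
          then have "card (nbrs S x) < k" using deepest[OF x(1)] x(2) by fastforce
          moreover have "card (nbrs R x) \<le> card (nbrs S x)"
            by (rule card_mono[OF finite_nbrs[OF SV] nbrs_mono[OF R]])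
          ultimately show ?thesis by simp
        qed
        have sp: "star_free (?X p - {p})"
          unfolding star_free_def
        proof
          fix x assume x: "x \<in> ?X p - {p}"
          have xS: "x \<in> S" using desc_subset[OF pS] x by blast
          obtain u where u: "u \<in> ?X p" "u \<in> S" "x \<in> kids d S u" using desc_pred x by blast
          have du: "d x = Suc (d u)" by (rule kids_Suc[OF rk SV u(2,3)])
          have ux: "u \<in> nbrs S x" using nbrs_sym kids_D[OF u(3)] u(2) by blast
          have Rp: "?X p - {p} \<subseteq> S" using desc_subset[OF pS] by blast
          show "card (nbrs (?X p - {p}) x) < k"
          proof (cases "u = p")
            case True
            show ?thesis by (rule reduced[OF xS _ Rp ux]) (use True du dp in auto)
          next
            case False
            then have "d c < d x" using desc_ge[OF u(1)] du dp by auto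
            then have "card (nbrs S x) < k" using deepest[OF xS] by fastforce
            moreover have "card (nbrs (?X p - {p}) x) \<le> card (nbrs S x)"
              by (rule card_mono[OF finite_nbrs[OF SV] nbrs_mono[OF Rp]])
            ultimately show ?thesis by simp
          qed
        qed
        note wp = weight_desc_ge_kid[OF rk SV pS cp]
        show False
        proof (cases "\<exists>g\<in>nbrs S p. d g < d p")
          case False
          then have ng: "\<not> d q < d p" if "q \<in> nbrs S p" for q using that by blast
          have np: "nbrs S p = kids d S p" using nbrs_kids_root[OF rk SV pS] ng by blast
          \<comment> \<open>Here \<open>p\<close> is a leaf if \<open>c\<close> is its only child, and then the \<open>k\<close>-star at \<open>c\<close> uses \<open>p\<close> as a leaf.\<close>
          have pt: "p \<in> tips S" if "kids d S p = {c}" using np that pS by (simp add: tips_def)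
          have "2 * k + 1 \<le> weight S (?X p)" using wp wc pt by (cases "kids d S p = {c}") auto
          moreover have "star_free (?X p - insert p (nbrs S p))"
            by (rule star_free_mono[OF sp]) (use sub[OF pS] in auto)
          ultimately have w: "weight S (?X p) = 2 * k + 1" and ext: "extremal (S - ?X p)"
            using root[OF detached_desc[OF rk SV pS ng]] contra by auto
          then have kp: "kids d S p = {c}" using wp wc two_le_k by (cases "kids d S p = {c}") (auto split: if_splits)
          then have wc': "weight S (?X c) \<le> 2 * k - 1" using wp w pt by simp
          have "?X p = insert c (nbrs S c)"
            using desc_unfold[OF rk SV pS] kp Xc[OF wc'] nc(1) by auto
          moreover have "nbrs S y = {c}" if "y \<in> nbrs S c" for y
            using that tips_c[OF wc'] nc(1) np kp by auto
          ultimately have "extremal S" using star_component_extremal[OF SV c(1) ck(2)] ext by blast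
          then show False using contra by blast
        next
          case True
          then obtain g where g: "g \<in> nbrs S p" "d g < d p" by blast
          have gS: "g \<in> S" using g nbrs_subset by blast
          have pg: "p \<in> kids d S g" using g nbrs_sym[OF g(1) pS] by (simp add: kids_def)
          then have dg: "d p = Suc (d g)" using kids_Suc[OF rk SV gS] by blast
          \<comment> \<open>Weight at most \<open>2 k\<close> leaves room for neither a second child of \<open>p\<close> nor a child of \<open>c\<close> that is no leaf.\<close>
          have "weight S (?X p) \<le> 2 * k"
            using heavy[OF branch_desc[OF rk SV pS g] sp] contra by fastforce
          then have kp: "kids d S p = {c}" and wc': "weight S (?X c) \<le> 2 * k - 1"
            using wp wc two_le_k by (auto split: if_splits)
          have wp': "2 * k \<le> weight S (?X p)" using wp wc kp by (auto split: if_splits)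
          \<comment> \<open>Deleting \<open>g\<close> alone does not destroy the star at \<open>c\<close>; its closed neighbourhood has to go.\<close>
          have sg: "star_free (?X g - insert g (nbrs S g))"
            unfolding star_free_def
          proof
            fix x assume x: "x \<in> ?X g - insert g (nbrs S g)"
            have xS: "x \<in> S" using desc_subset[OF gS] x by blast
            obtain u where u: "u \<in> ?X g" "u \<in> S" "x \<in> kids d S u" using desc_pred x by blast
            have du: "d x = Suc (d u)" by (rule kids_Suc[OF rk SV u(2,3)])
            have ux: "u \<in> nbrs S x" using nbrs_sym kids_D[OF u(3)] u(2) by blast
            have "u \<noteq> g" using x kids_D[OF u(3)] by blast
            then obtain t where t: "t \<in> ?X g" "t \<in> S" "u \<in> kids d S t" using desc_pred u(1) by blast
            have dt: "d u = Suc (d t)" by (rule kids_Suc[OF rk SV t(2,3)])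
            have Rg: "?X g - insert g (nbrs S g) \<subseteq> S" using desc_subset[OF gS] by blast
            show "card (nbrs (?X g - insert g (nbrs S g)) x) < k"
            proof (cases "t = g")
              case True
              then have "u \<in> nbrs S g" using kids_D[OF t(3)] by blast
              then show ?thesis
                by (intro reduced[OF xS _ Rg ux]) (use True du dt dp dg in auto)
            next
              case False
              then have "d c < d x" using desc_ge[OF t(1)] du dt dp dg by auto
              then have "card (nbrs S x) < k" using deepest[OF xS] by fastforce
              moreover have "card (nbrs (?X g - insert g (nbrs S g)) x) \<le> card (nbrs S x)"
                by (rule card_mono[OF finite_nbrs[OF SV] nbrs_mono[OF Rg]])
              ultimately show ?thesis by simp
            qed
          qed
          note wg = weight_desc_ge_kid[OF rk SV gS pg]
          have wg': "2 * k + 1 \<le> weight S (?X g)" using wg wp' by (auto split: if_splits)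
          show False
          proof (cases "\<exists>h\<in>nbrs S g. d h < d g")
            case False
            then have nh: "\<not> d q < d g" if "q \<in> nbrs S g" for q using that by blast
            have ng: "nbrs S g = kids d S g" using nbrs_kids_root[OF rk SV gS] nh by blast
            \<comment> \<open>A root \<open>g\<close> is a leaf or has a second child, so the component is too heavy for equality.\<close>
            have gt: "g \<in> tips S" if "kids d S g = {p}" using ng that gS by (simp add: tips_def)
            have "2 * k + 2 \<le> weight S (?X g)"
              using wg wp' gt by (cases "kids d S g = {p}") (auto split: if_splits)
            then show False
              using root[OF detached_desc[OF rk SV gS nh] sg wg'] contra by auto
          next
            case True
            then obtain h where h: "h \<in> nbrs S g" "d h < d g" by blast
            note br = branch_desc[OF rk SV gS h]
            have "weight S (?X g) = 2 * k + 1"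
              using branch_cut[OF SV br sg wg' IH] contra by blast
            then have kg: "kids d S g = {p}" using wg wp' by (auto split: if_splits)
            have X: "?X g = {g, p, c} \<union> kids d S c"
              using desc_unfold[OF rk SV gS] kg desc_unfold[OF rk SV pS] kp Xc[OF wc'] by auto
            have "x \<notin> {g, p, c}" if "x \<in> kids d S c" for x using kids_D[OF that] dp dg by auto
            then have "kids d S c \<inter> {g, p, c} = {}" by blast
            moreover have "distinct [g, p, c]" using dp dg by auto
            moreover have "nbrs S g = {h, p}" using nbrs_kids[OF rk SV gS h] kg by simp
            moreover have "nbrs S p = {g, c}" using nbrs_kids[OF rk SV pS g] kp by simp
            moreover have "\<forall>y\<in>kids d S c. nbrs S y = {c}" using tips_c[OF wc'] by blast
            ultimately have "pendant S (?X g) g h"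
              unfolding pendant_def using X nc(1) ck(2) by blast
            then show False
              using pendant_branch_dichotomy[OF SV br _ sg wg' IH] contra by blast
          qed
        qed
      qed
    qed
  qed
qed

end

section \<open>Rankings of undirected trees\<close>
lemma (in graph) graph_induce:
  assumes "S \<subseteq> verts G"
  shows "graph (G \<restriction> S)"
proof -
  have i: "induced_subgraph (G \<restriction> S) G" using assms by auto
  have "digraph (G \<restriction> S)" by (rule digraphI_induced[OF i])
  moreover have "symmetric (G \<restriction> S)" by (rule induced_graph_imp_symmetric[OF sym_arcs i])
  ultimately show ?thesis by (rule digraph.graphI)
qed

lemma dominates_induce_iff: "u \<rightarrow>\<^bsub>G \<restriction> S\<^esub> v \<longleftrightarrow> u \<in> S \<and> v \<in> S \<and> u \<rightarrow>\<^bsub>G\<^esub> v"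
  by (auto simp: arcs_ends_conv)

lemma (in graph) adj_sym: "u \<rightarrow>\<^bsub>G\<^esub> v \<Longrightarrow> v \<rightarrow>\<^bsub>G\<^esub> u"
  using arcs_ends_symmetric[OF sym_arcs] .

lemma undirected_forest_induce:
  assumes "undirected_forest G" "S \<subseteq> verts G"
  shows "undirected_forest (G \<restriction> S)"
proof -
  interpret graph G using assms by (simp add: undirected_forest_def)
  have "subgraph (G \<restriction> S) G" using assms(2) by (rule subgraph_induce_subgraphI)
  then show ?thesis
    using assms subgraph_cycle graph_induce unfolding undirected_forest_def by blast
qed

text \<open>
  A path inside \<open>W\<close> between two different neighbours of \<open>x\<close> would close to a cycle through \<open>x\<close>.
\<close>
lemma forest_one_attachment:
  assumes "undirected_forest G" and W: "W \<subseteq> verts G" and x: "x \<notin> W"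
    and w: "w \<in> W" "w \<rightarrow>\<^sup>*\<^bsub>G \<restriction> W\<^esub> w'" "x \<rightarrow>\<^bsub>G\<^esub> w" "x \<rightarrow>\<^bsub>G\<^esub> w'"
  shows "w = w'"
proof (rule ccontr)
  assume ne: "w \<noteq> w'"
  interpret graph G using assms by (simp add: undirected_forest_def)
  interpret W: wf_digraph "G \<restriction> W" ..
  obtain p where pW: "pre_digraph.apath (G \<restriction> W) w p w'" using w(2) W.reachable_apath by blast
  have sub: "subgraph (G \<restriction> W) G" using W by (rule subgraph_induce_subgraphI)
  have p: "apath w p w'" by (rule subgraph_apath_imp_apath[OF pW sub])
  have "set (awalk_verts w p) \<subseteq> W"
    using pW awalk_verts_induce by (metis W.awalkE induce_subgraph_verts pre_digraph.apath_def)
  then have xp: "x \<notin> set (awalk_verts w p)" using x by blast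
  have pne: "p \<noteq> []" using p ne by (auto simp: apath_Nil_iff)
  obtain e where e: "e \<in> arcs G" "tail G e = x" "head G e = w" using w(3) by blast
  obtain e' where e': "e' \<in> arcs G" "tail G e' = w'" "head G e' = x" using adj_sym[OF w(4)] by blast
  have aw: "awalk w p w'" "awlast w p = w'" using p by (auto simp: apath_def)
  then have "awalk w (p @ [e']) x" using e' by (auto simp: awalk_simps)
  then have "awalk x (e # p @ [e']) x" using e by (auto simp: awalk_simps)
  moreover have "awalk_verts w (p @ [e']) = awalk_verts w p @ [x]"
    using awalk_verts_append[OF \<open>awalk w (p @ [e']) x\<close>] aw e' by simp
  ultimately have "cycle (e # p @ [e'])"
    unfolding cycle_def using p xp e by (intro exI[of _ x]) (auto simp: apath_def)
  moreover have "3 \<le> length (e # p @ [e'])" using pne by (cases p) auto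
  ultimately show False using assms(1) unfolding undirected_forest_def by blast
qed

lemma (in wf_digraph) reachable_leaves_set:
  assumes "u \<rightarrow>\<^sup>*\<^bsub>G\<^esub> v" "u \<in> W" "v \<notin> W"
  shows "\<exists>x\<in>W. \<exists>y. y \<notin> W \<and> x \<rightarrow>\<^bsub>G\<^esub> y"
proof (rule ccontr)
  assume a: "\<not> ?thesis"
  have "v \<in> W" using assms(1) by (induction rule: reachable_induct) (use assms(2) a in blast)+
  then show False using assms(3) by blast
qed

text \<open>
  A connected set \<open>W\<close> that contains the root and carries a ranking is enlarged by one vertex at a time.
  By \<open>forest_one_attachment\<close> the new vertex has exactly one neighbour in \<open>W\<close>, its parent. The clause on
  parents, that only \<open>r\<close> lacks one, makes the root reachable inside every set closed under parents.
\<close>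
lemma undirected_tree_ranking:
  assumes T: "undirected_tree G" and r: "r \<in> verts G"
  shows "\<exists>d. ranking (verts G) (dominates G) d \<and> d r = 0 \<and>
    (\<forall>x\<in>verts G. x \<noteq> r \<longrightarrow> (\<exists>y. x \<rightarrow>\<^bsub>G\<^esub> y \<and> d y < d x))"
proof -
  have uf: "undirected_forest G" using T by (simp add: undirected_tree_def)
  then interpret graph G by (simp add: undirected_forest_def)
  have conn: "strongly_connected G"
    using symmetric_connected_imp_strongly_connected[OF sym_arcs] T by (simp add: undirected_tree_def)
  define P where "P W d \<longleftrightarrow> W \<subseteq> verts G \<and> r \<in> W \<and> (\<forall>x\<in>W. r \<rightarrow>\<^sup>*\<^bsub>G \<restriction> W\<^esub> x) \<and>
    ranking W (dominates G) d \<and> d r = 0 \<and>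
    (\<forall>x\<in>W. x \<noteq> r \<longrightarrow> (\<exists>y\<in>W. x \<rightarrow>\<^bsub>G\<^esub> y \<and> d y < d x))" for W and d :: "'a \<Rightarrow> nat"
  have irr: "\<not> x \<rightarrow>\<^bsub>G\<^esub> x" for x using adj_not_same by blast
  have "\<exists>W d. P W d \<and> n \<le> card W" if "n \<le> card (verts G)" for n
    using that
  proof (induction n)
    case 0
    have "P {r} (\<lambda>_. 0)"
      unfolding P_def ranking_def using r irr
      by (auto intro: wf_digraph.reachable_refl[OF wellformed_induce_subgraph])
    then show ?case by blast
  next
    case (Suc n)
    then obtain W d where W: "P W d" "n \<le> card W" by auto
    show ?case
    proof (cases "Suc n \<le> card W")
      case False
      have WV: "W \<subseteq> verts G" "r \<in> W" and reach: "\<And>x. x \<in> W \<Longrightarrow> r \<rightarrow>\<^sup>*\<^bsub>G \<restriction> W\<^esub> x"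
        and rk: "ranking W (dominates G) d" "d r = 0"
        and par: "\<And>x. x \<in> W \<Longrightarrow> x \<noteq> r \<Longrightarrow> \<exists>y\<in>W. x \<rightarrow>\<^bsub>G\<^esub> y \<and> d y < d x"
        using W unfolding P_def by auto
      have "W \<noteq> verts G" using False Suc.prems by auto
      then obtain z where z: "z \<in> verts G" "z \<notin> W" using WV by blast
      then have "r \<rightarrow>\<^sup>*\<^bsub>G\<^esub> z" using conn r unfolding strongly_connected_def by blast
      then obtain w x where wx: "w \<in> W" "x \<notin> W" "w \<rightarrow>\<^bsub>G\<^esub> x"
        using reachable_leaves_set WV z by metis
      have xV: "x \<in> verts G" using wx adj_in_verts by blast
      interpret W: graph "G \<restriction> W" by (rule graph_induce[OF WV(1)])
      have only: "y = w" if "y \<in> W" "x \<rightarrow>\<^bsub>G\<^esub> y" for y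
      proof -
        have "y \<rightarrow>\<^sup>*\<^bsub>G \<restriction> W\<^esub> w"
          using symmetric_reachable[OF W.sym_arcs reach[OF that(1)]] reach[OF wx(1)] W.reachable_trans
          by blast
        then show ?thesis
          using forest_one_attachment[OF uf WV(1) wx(2) that(1)] that(2) adj_sym[OF wx(3)] by blast
      qed
      define d' where "d' = d(x := Suc (d w))"
      have d': "d' y = d y" if "y \<in> W" for y using that wx by (auto simp: d'_def)
      have d'x: "d' x = Suc (d w)" by (simp add: d'_def)
      let ?W = "insert x W"
      interpret W': wf_digraph "G \<restriction> ?W" ..
      have "P ?W d'"
        unfolding P_def
      proof (intro conjI ballI impI)
        show "?W \<subseteq> verts G" "r \<in> ?W" using WV xV by auto
        show "d' r = 0" using d' WV rk by simp
        have old: "r \<rightarrow>\<^sup>*\<^bsub>G \<restriction> ?W\<^esub> y" if "y \<in> W" for y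
          using reachable_induce_ss[OF reach[OF that]] by blast
        moreover have "w \<rightarrow>\<^bsub>G \<restriction> ?W\<^esub> x" using wx by (simp add: dominates_induce_iff)
        ultimately have "r \<rightarrow>\<^sup>*\<^bsub>G \<restriction> ?W\<^esub> x" using W'.reachable_adj_trans wx(1) by blast
        then show "r \<rightarrow>\<^sup>*\<^bsub>G \<restriction> ?W\<^esub> y" if "y \<in> ?W" for y using old that by blast
        show "\<exists>z\<in>?W. y \<rightarrow>\<^bsub>G\<^esub> z \<and> d' z < d' y" if y: "y \<in> ?W" "y \<noteq> r" for y
        proof (cases "y = x")
          case True
          then show ?thesis using adj_sym[OF wx(3)] d'[OF wx(1)] d'x wx(1)
            by (intro bexI[of _ w]) auto
        next
          case False
          then have yW: "y \<in> W" using y by blast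
          then obtain z where "z \<in> W" "y \<rightarrow>\<^bsub>G\<^esub> z" "d z < d y" using par y by blast
          then show ?thesis using d' yW by auto
        qed
        have into_x: "y = w" if "y \<in> W" "y \<rightarrow>\<^bsub>G\<^esub> x" for y
          using only[OF that(1) adj_sym[OF that(2)]] .
        show "ranking ?W (dominates G) d'"
          unfolding ranking_def
        proof (intro conjI ballI impI)
          fix y z assume yz: "y \<in> ?W" "z \<in> ?W" "y \<rightarrow>\<^bsub>G\<^esub> z"
          consider "y = x" "z \<in> W" | "z = x" "y \<in> W" | "y \<in> W" "z \<in> W" using yz irr by blast
          then show "d' z = Suc (d' y) \<or> d' y = Suc (d' z)"
          proof cases
            case 1
            then show ?thesis using only[of z] yz(3) d'x d' by simp
          next
            case 2
            then show ?thesis using into_x[of y] yz(3) d'x d' by simp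
          next
            case 3
            then show ?thesis using rk(1) yz(3) d' unfolding ranking_def by simp
          qed
        next
          fix y z z' assume y: "y \<in> ?W" and z: "z \<in> ?W" and z': "z' \<in> ?W"
            and e: "y \<rightarrow>\<^bsub>G\<^esub> z \<and> y \<rightarrow>\<^bsub>G\<^esub> z' \<and> d' z < d' y \<and> d' z' < d' y"
          show "z = z'"
          proof (cases "y = x")
            case True
            then show ?thesis using only[of z] only[of z'] e z z' irr by auto
          next
            case False
            then have yW: "y \<in> W" using y by blast
            have "u \<in> W" if "u \<in> ?W" "y \<rightarrow>\<^bsub>G\<^esub> u" "d' u < d' y" for u
              using that into_x[OF yW] d'[OF yW] d'x by auto
            then have "z \<in> W" "z' \<in> W" using z z' e by blast+
            then show ?thesis using rk(1) yW e d' unfolding ranking_def by metis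
          qed
        qed
      qed
      moreover have "Suc n \<le> card ?W"
        using W(2) wx(2) WV(1) by (simp add: finite_subset[OF WV(1)])
      ultimately show ?thesis by blast
    qed (use W in blast)
  qed
  then obtain W d where W: "P W d" "card (verts G) \<le> card W" by blast
  then have "W = verts G" unfolding P_def by (meson card_seteq finite_verts)
  then show ?thesis using W unfolding P_def by blast
qed

section \<open>Transfer to graphs\<close>
lemma tree_rankable:
  assumes T: "undirected_tree T" and "2 \<le> k"
  shows "rankable (verts T) (dominates T) k"
proof -
  interpret graph T using T by (simp add: undirected_tree_def undirected_forest_def)
  show ?thesis
  proof unfold_locales
    show "\<exists>d. ranking (verts T) (dominates T) d \<and> d r = 0" if "r \<in> verts T" for r
      using undirected_tree_ranking[OF T that] by blast
  qed (use assms(2) adj_sym in auto)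
qed

locale isolation_tree =
  fixes T :: "('a, 'b) pre_digraph" and k :: nat
  assumes tree: "undirected_tree T" and two_le: "2 \<le> k"

sublocale isolation_tree \<subseteq> graph T
  using tree by (simp add: undirected_tree_def undirected_forest_def)

sublocale isolation_tree \<subseteq> rankable "verts T" "dominates T" k
  using tree_rankable[OF tree two_le] .

context isolation_tree
begin

lemma nbhd_eq_nbrs: "nbhd T u = nbrs (verts T) u"
  using adj_in_verts by (auto simp: nbhd_def nbrs_def)

lemma leaves_eq_tips: "leaves T = tips (verts T)"
  by (simp add: leaves_def tips_def degree_def nbhd_eq_nbrs)

text \<open>
  A vertex with at least \<open>k\<close> neighbours in \<open>U\<close> and \<open>k\<close> of these neighbours, with only the arcs between
  them and that vertex, form a \<open>k\<close>-star, whatever other edges are present.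
\<close>
lemma star_free_iff_no_star_subgraph:
  assumes U: "U \<subseteq> verts T"
  shows "star_free U \<longleftrightarrow> \<not> (\<exists>H. subgraph H (T \<restriction> U) \<and> K\<^bsub>1,k\<^esub> H)"
proof
  assume sf: "star_free U"
  show "\<not> (\<exists>H. subgraph H (T \<restriction> U) \<and> K\<^bsub>1,k\<^esub> H)"
  proof
    assume "\<exists>H. subgraph H (T \<restriction> U) \<and> K\<^bsub>1,k\<^esub> H"
    then obtain H :: "('a, 'b) pre_digraph" and C W where H: "subgraph H (T \<restriction> U)" "verts H = C \<union> W"
      "card C = 1" "card W = k" "arcs_ends H = C \<times> W \<union> W \<times> C"
      unfolding complete_bipartite_digraph_def by blast
    then obtain c where c: "C = {c}" by (auto simp: card_1_singleton_iff)
    have cU: "c \<in> U" using H(1,2) c by (auto simp: subgraph_def)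
    have "W \<subseteq> nbrs U c"
    proof
      fix w assume "w \<in> W"
      then have "c \<rightarrow>\<^bsub>H\<^esub> w" using H(5) c by blast
      then have "c \<rightarrow>\<^bsub>T \<restriction> U\<^esub> w" using pre_digraph.adj_mono[OF _ H(1)] by blast
      then show "w \<in> nbrs U c" by (simp add: dominates_induce_iff nbrs_def)
    qed
    then have "k \<le> card (nbrs U c)" using card_mono[OF finite_nbrs[OF U]] H(4) by blast
    then show False using sf cU by (auto simp: star_free_def)
  qed
next
  assume no: "\<not> (\<exists>H. subgraph H (T \<restriction> U) \<and> K\<^bsub>1,k\<^esub> H)"
  show "star_free U"
    unfolding star_free_def
  proof (rule ballI, rule ccontr)
    fix c assume c: "c \<in> U" "\<not> card (nbrs U c) < k"
    then obtain W where W: "W \<subseteq> nbrs U c" "card W = k"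
      by (metis not_less obtain_subset_with_card_n)
    have WU: "W \<subseteq> U" "c \<notin> W" using W nbrs_subset E_irrefl c U by (auto simp: nbrs_def)
    have finW: "finite W" using WU U finite_sub by (meson finite_subset)
    define H where "H = \<lparr>verts = insert c W,
      arcs = {e \<in> arcs T. tail T e = c \<and> head T e \<in> W \<or> tail T e \<in> W \<and> head T e = c},
      tail = tail T, head = head T\<rparr>"
    have ends: "arcs_ends H = {c} \<times> W \<union> W \<times> {c}"
    proof -
      have "c \<rightarrow>\<^bsub>T\<^esub> w" "w \<rightarrow>\<^bsub>T\<^esub> c" if "w \<in> W" for w
        using W that adj_sym by (auto simp: nbrs_def)
      note adj = this
      show ?thesis
      proof (intro equalityI subrelI)
        fix u v assume "(u, v) \<in> arcs_ends H"
        then show "(u, v) \<in> {c} \<times> W \<union> W \<times> {c}" by (auto simp: arcs_ends_conv H_def)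
      next
        fix u v assume uv: "(u, v) \<in> {c} \<times> W \<union> W \<times> {c}"
        then have "u \<rightarrow>\<^bsub>T\<^esub> v" using adj by blast
        then obtain e where "e \<in> arcs T" "tail T e = u" "head T e = v" by blast
        then show "(u, v) \<in> arcs_ends H" using uv by (auto simp: arcs_ends_conv H_def)
      qed
    qed
    have "wf_digraph H" by unfold_locales (auto simp: H_def)
    then have subU: "subgraph H (T \<restriction> U)"
      using WU c(1) unfolding subgraph_def by (auto simp: H_def compatible_def)
    then have "subgraph H T"
      using subgraph_induce_subgraphI[OF U] subgraph_trans by blast
    then have "digraph H" by (rule digraph_subgraph)
    moreover have "symmetric H" unfolding symmetric_def ends by (auto simp: sym_def)
    ultimately have "graph H" by (rule digraph.graphI)
    moreover have "verts H = {c} \<union> W" "{c} \<inter> W = {}" "card {c} = 1"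
      using WU by (auto simp: H_def)
    ultimately have "K\<^bsub>1,k\<^esub> H"
      unfolding complete_bipartite_digraph_def using ends W(2) by blast
    then show False using no subU by blast
  qed
qed

lemma isolating_set_iff: "isolating_set k T D \<longleftrightarrow> isolates (verts T) D"
proof -
  have "closed_nbhd T D = dominated (verts T) D"
    by (auto simp: closed_nbhd_def dominated_def nbhd_eq_nbrs)
  then show ?thesis
    using star_free_iff_no_star_subgraph[of "verts T - dominated (verts T) D"]
    by (auto simp: isolating_set_def isolates_def)
qed

lemma isolation_number_attained: "\<exists>D. isolates (verts T) D \<and> card D = isolation_number k T"
proof -
  have "isolates (verts T) (verts T)"
    by (auto simp: isolates_def dominated_def star_free_def)
  then show ?thesis
    unfolding isolation_number_def isolating_set_iff by (rule_tac LeastI_ex) blast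
qed

lemma isolation_number_le: "isolates (verts T) D \<Longrightarrow> isolation_number k T \<le> card D"
  unfolding isolation_number_def isolating_set_iff by (rule Least_le) blast

text \<open>
  A tree with an isolating set below the bound misses equality, which leaves the extremal trees; for
  these, the number of hubs is a lower bound on the isolation number and equals the upper bound.
\<close>
lemma isolation_number_eq_iff_extremal:
  "(2 * k + 1) * isolation_number k T = card (verts T) + card (leaves T) \<longleftrightarrow> extremal (verts T)"
proof -
  have w: "weight (verts T) (verts T) = card (verts T) + card (leaves T)"
    by (simp add: weight_def leaves_eq_tips tips_def Int_def conj_commute)
  show ?thesis
  proof
    assume eq: "(2 * k + 1) * isolation_number k T = card (verts T) + card (leaves T)"
    have "\<not> beats_bound (verts T)"
    proof
      assume "beats_bound (verts T)"
      then obtain D where "isolates (verts T) D" "(2 * k + 1) * card D < weight (verts T) (verts T)"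
        by (auto simp: beats_bound_def)
      moreover from this have "(2 * k + 1) * isolation_number k T \<le> (2 * k + 1) * card D"
        using isolation_number_le mult_le_mono2 by blast
      ultimately show False using eq w by linarith
    qed
    then show "extremal (verts T)" using beats_bound_or_extremal by blast
  next
    assume ext: "extremal (verts T)"
    then obtain f where f: "labelled (verts T) f" by (auto simp: extremal_def)
    obtain D where D: "isolates (verts T) D" "(2 * k + 1) * card D \<le> weight (verts T) (verts T)"
      using beats_bound_or_extremal_isolating[OF subset_refl] ext by blast
    have lw: "(2 * k + 1) * card (hubs (verts T) f) = weight (verts T) (verts T)"
      by (rule labelled_weight[OF f subset_refl])
    have "card (hubs (verts T) f) \<le> isolation_number k T"
      using isolation_number_attained hubs_le_isolating[OF f subset_refl] by metis
    then have "weight (verts T) (verts T) \<le> (2 * k + 1) * isolation_number k T"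
      using lw mult_le_mono2 by metis
    moreover have "(2 * k + 1) * isolation_number k T \<le> (2 * k + 1) * card D"
      using isolation_number_le[OF D(1)] by (rule mult_le_mono2)
    ultimately show "(2 * k + 1) * isolation_number k T = card (verts T) + card (leaves T)"
      using D(2) w by linarith
  qed
qed

lemma star_imp_extremal:
  assumes "K\<^bsub>1,k\<^esub> T"
  shows "extremal (verts T)"
proof -
  obtain C W where K: "verts T = C \<union> W" "C \<inter> W = {}" "card C = 1" "card W = k"
    "arcs_ends T = C \<times> W \<union> W \<times> C"
    using assms unfolding complete_bipartite_digraph_def by blast
  then obtain c where c: "C = {c}" by (auto simp: card_1_singleton_iff)
  have nb: "nbrs (verts T) c = W" "\<And>y. y \<in> W \<Longrightarrow> nbrs (verts T) y = {c}"
    using K(2) unfolding nbrs_def unfolding K(1,5) c by auto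
  have "c \<in> verts T" using K(1) c by simp
  moreover have "card (nbrs (verts T) c) = k" using nb(1) K(4) by simp
  moreover have "verts T - insert c (nbrs (verts T) c) = {}" using nb(1) K(1) c by simp
  then have "extremal (verts T - insert c (nbrs (verts T) c))"
    using extremal_empty by (simp only:)
  ultimately show ?thesis
    using star_component_extremal[OF subset_refl _ _ _ refl, of c] nb by simp
qed

text \<open>
  The edges between \<open>A\<close> and \<open>B\<close> are exactly the attached leaves, which gives each core its only
  link. A component of \<open>A\<close> with more than one vertex gives it a core neighbour.
\<close>
lemma family_imp_extremal:
  assumes "T \<in> family_T k"
  shows "extremal (verts T)"
proof -
  obtain A B C L where
    V: "verts T = A \<union> B \<union> C \<union> L" and disj: "A \<inter> B = {}" "A \<inter> C = {}" "A \<inter> L = {}" "B \<inter> C = {}"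
      "B \<inter> L = {}" "C \<inter> L = {}"
    and L: "L = leaves T" "\<forall>u\<in>L. nbhd T u \<subseteq> C"
    and A: "\<forall>H \<in> pre_digraph.sccs (T \<restriction> A). 1 < card (verts H)"
    and AB: "leaf_attached T A B"
    and B: "\<forall>u\<in>B. degree T u = 2 \<and> card (nbhd T u \<inter> A) = 1 \<and> card (nbhd T u \<inter> C) = 1"
    and C: "\<forall>u\<in>C. degree T u = k \<and> nbhd T u \<inter> B \<noteq> {} \<and> nbhd T u \<subseteq> B \<union> L"
    using assms unfolding family_T_def mem_Collect_eq
    by (elim conjE exE) (rule that; assumption)
  let ?n = "nbrs (verts T)"
  note B' = B[unfolded degree_def nbhd_eq_nbrs] and C' = C[unfolded degree_def nbhd_eq_nbrs]
    and L' = L(2)[unfolded nbhd_eq_nbrs]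
  define f where "f x = (if x \<in> A then Core else if x \<in> B then Link else if x \<in> C then Hub else Tip)" for x
  have fA: "f x = Core \<longleftrightarrow> x \<in> A" and fB: "x \<in> B \<Longrightarrow> f x = Link" and fC: "x \<in> C \<Longrightarrow> f x = Hub"
    and fL: "x \<in> L \<Longrightarrow> f x = Tip" for x
    using disj by (auto simp: f_def)
  obtain \<phi> where \<phi>: "bij_betw \<phi> A B"
    and ends: "arcs_ends (T \<restriction> (A \<union> B)) =
          arcs_ends (T \<restriction> A) \<union> {(a, \<phi> a) | a. a \<in> A} \<union> {(\<phi> a, a) | a. a \<in> A}"
    using AB unfolding leaf_attached_def by blast
  have symn: "x \<in> ?n y" if "y \<in> ?n x" for x y
    using that adj_sym adj_in_verts by (auto simp: nbrs_def)
  have inV: "y \<in> verts T" if "y \<in> ?n x" for x y using that nbrs_subset by blast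
  have "role_ok (verts T) f x" if x: "x \<in> verts T" for x
  proof -
    consider "x \<in> A" | "x \<in> B" | "x \<in> C" | "x \<in> L" using x V by blast
    then show ?thesis
    proof cases
      case 1
      have \<phi>B: "\<phi> x \<in> B" using \<phi> 1 by (auto simp: bij_betw_def)
      have "(x, \<phi> x) \<in> arcs_ends (T \<restriction> (A \<union> B))" using ends 1 by blast
      then have \<phi>n: "\<phi> x \<in> ?n x" using \<phi>B V by (auto simp: dominates_induce_iff nbrs_def)
      have other: "f y = Core" if y: "y \<in> ?n x" "y \<noteq> \<phi> x" for y
      proof -
        have "y \<notin> C" using C' symn[OF y(1)] 1 disj(1,3) by blast
        moreover have "y \<notin> L" using L' symn[OF y(1)] 1 disj(2) by blast
        moreover have "y \<notin> B"
        proof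
          assume "y \<in> B"
          then have "(x, y) \<in> arcs_ends (T \<restriction> (A \<union> B))"
            using 1 y(1) by (simp add: dominates_induce_iff nbrs_def)
          then have "(x, y) \<in> arcs_ends (T \<restriction> A) \<or> y = \<phi> x \<or> (\<exists>a\<in>A. x = \<phi> a)"
            unfolding ends by blast
          moreover have "\<phi> a \<in> B" if "a \<in> A" for a using \<phi> that by (auto simp: bij_betw_def)
          ultimately show False using y(2) \<open>y \<in> B\<close> 1 disj(1) by (auto simp: dominates_induce_iff)
        qed
        ultimately show ?thesis using inV[OF y(1)] V fA by blast
      qed
      have "\<exists>a\<in>?n x. f a = Core"
      proof -
        interpret A: graph "T \<restriction> A" by (rule graph_induce) (use V in blast)
        have "A.scc_of x \<in> A.sccs_verts" by (rule A.scc_of_in_sccs_verts) (use 1 in simp)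
        then obtain H where H: "H \<in> A.sccs" "A.scc_of x = verts H" unfolding A.sccs_verts_conv by blast
        then have "1 < card (A.scc_of x)" using A by simp
        then obtain y where y: "y \<in> A.scc_of x" "y \<noteq> x"
        proof -
          have "A.scc_of x \<noteq> {}" "A.scc_of x \<noteq> {x}"
            using \<open>1 < card (A.scc_of x)\<close> by auto
          then show ?thesis using that by blast
        qed
        then have "x \<rightarrow>\<^sup>*\<^bsub>T \<restriction> A\<^esub> y" by (simp add: A.scc_of_def)
        then obtain z where "x \<rightarrow>\<^bsub>T \<restriction> A\<^esub> z"
          using y(2) by (cases rule: A.converse_reachable_cases) auto
        then show ?thesis using fA V by (auto simp: dominates_induce_iff nbrs_def)
      qed
      moreover have "f x = Core" using fA 1 by blast
      ultimately show ?thesis unfolding role_ok_def using \<phi>n fB[OF \<phi>B] other by auto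
    next
      case 2
      obtain a c where ac: "?n x \<inter> A = {a}" "?n x \<inter> C = {c}"
        using B' 2 by (metis card_1_singletonE)
      have ne: "a \<noteq> c" using ac disj by blast
      have "{a, c} \<subseteq> ?n x" using ac by blast
      moreover have "card (?n x) = 2" using B' 2 by simp
      moreover have "finite (?n x)" by (rule finite_nbrs) simp
      ultimately have "?n x = {a, c}" using ne by (metis card_2_iff card_subset_eq)
      moreover have "f a = Core" "f c = Hub" "f x = Link" using ac fA fC fB 2 by blast+
      ultimately show ?thesis unfolding role_ok_def by auto
    next
      case 3
      show ?thesis
      proof -
        have "f y = Link \<or> f y = Tip" if "y \<in> ?n x" for y using C' 3 fB fL that by blast
        then show ?thesis using C' 3 fC[OF 3] by (simp add: role_ok_def)
      qed
    next
      case 4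
      then obtain c where c: "?n x = {c}"
        using L(1) by (auto simp: leaves_def degree_def nbhd_eq_nbrs card_1_singleton_iff)
      then have "f c = Hub" using L' 4 fC by blast
      then show ?thesis using c fL[OF 4] by (simp add: role_ok_def)
    qed
  qed
  then show ?thesis unfolding extremal_def labelled_def by blast
qed

lemma strongly_connected_tree: "strongly_connected T"
  using symmetric_connected_imp_strongly_connected[OF sym_arcs] tree by (simp add: undirected_tree_def)

text \<open>
  A hub all of whose neighbours are tips forms, together with them, a connected component, hence the
  whole tree. If there is no such hub, the role classes satisfy the conditions of \<open>\<T>\<^sub>k\<close>.
\<close>
lemma extremal_imp_star_or_family:
  assumes "extremal (verts T)"
  shows "K\<^bsub>1,k\<^esub> T \<or> T \<in> family_T k"
proof -
  let ?n = "nbrs (verts T)"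
  obtain f where l: "labelled (verts T) f" using assms by (auto simp: extremal_def)
  have nE: "y \<in> ?n x \<longleftrightarrow> x \<rightarrow>\<^bsub>T\<^esub> y" for x y using adj_in_verts by (auto simp: nbrs_def)
  have symn: "x \<in> ?n y" if "y \<in> ?n x" for x y using that adj_sym nE by blast
  have inV: "y \<in> verts T" "x \<in> verts T" if "y \<in> ?n x" for x y
    using that nE[of y x] adj_in_verts[of x y] by simp_all
  note core = labelled_Core[OF l] and link = labelled_Link[OF l] and hub = labelled_Hub[OF l]
    and tip = labelled_Tip[OF l]
  show ?thesis
  proof (cases "\<exists>c\<in>verts T. f c = Hub \<and> (\<forall>y\<in>?n c. f y = Tip)")
    case True
    then obtain c where c: "c \<in> verts T" "f c = Hub" "\<forall>y\<in>?n c. f y = Tip" by blast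
    have ny: "?n y = {c}" if y: "y \<in> ?n c" for y
      using tip[OF inV(1)[OF y]] c(3) y symn[OF y] by auto
    have closed: "y \<in> insert c (?n c)" if "x \<in> insert c (?n c)" "x \<rightarrow>\<^bsub>T\<^esub> y" for x y
      using that ny nE by auto
    have V: "verts T = insert c (?n c)"
    proof (rule ccontr)
      assume "verts T \<noteq> insert c (?n c)"
      then obtain z where z: "z \<in> verts T" "z \<notin> insert c (?n c)" using c(1) inV by blast
      then have "c \<rightarrow>\<^sup>*\<^bsub>T\<^esub> z" using strongly_connected_tree c(1) by (auto simp: strongly_connected_def)
      then show False using reachable_leaves_set[of c z "insert c (?n c)"] z closed by blast
    qed
    have cn: "c \<notin> ?n c" using E_irrefl[OF c(1)] by (simp add: nbrs_def)
    have "arcs_ends T = {c} \<times> ?n c \<union> ?n c \<times> {c}"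
    proof (intro equalityI subrelI)
      fix u v assume uv: "u \<rightarrow>\<^bsub>T\<^esub> v"
      then have "u = c \<or> u \<in> ?n c" using adj_in_verts(1)[OF uv] V by blast
      then show "(u, v) \<in> {c} \<times> ?n c \<union> ?n c \<times> {c}" using uv ny nE[of v u] by auto
    next
      fix u v assume "(u, v) \<in> {c} \<times> ?n c \<union> ?n c \<times> {c}"
      then show "u \<rightarrow>\<^bsub>T\<^esub> v" using nE[of v u] ny by auto
    qed
    moreover have "verts T = {c} \<union> ?n c" "{c} \<inter> ?n c = {}" "card {c} = 1" using V cn by auto
    moreover have "card (?n c) = k" using hub(1) c by blast
    moreover have "graph T" by unfold_locales
    ultimately have "K\<^bsub>1,k\<^esub> T" unfolding complete_bipartite_digraph_def by blast
    then show ?thesis by blast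
  next
    case False
    define X where "X r = {x \<in> verts T. f x = r}" for r
    have tips: "X Tip = leaves T" using labelled_tips[OF l subset_refl] by (simp add: leaves_eq_tips X_def)
    have V: "verts T = X Core \<union> X Link \<union> X Hub \<union> X Tip"
      unfolding X_def using role.exhaust by blast
    have XV: "X r \<subseteq> verts T" for r by (auto simp: X_def)
    have disj: "X r \<inter> X s = {}" if "r \<noteq> s" for r s using that by (auto simp: X_def)
    have uf: "undirected_forest T" using tree by (simp add: undirected_tree_def)
    have c_tip: "\<forall>u\<in>X Tip. nbhd T u \<subseteq> X Hub"
      using tip inV by (fastforce simp: X_def nbhd_eq_nbrs)
    have c_comp: "\<forall>H \<in> pre_digraph.sccs (T \<restriction> X Core). 1 < card (verts H)"
    proof
      interpret A: graph "T \<restriction> X Core" by (rule graph_induce[OF XV])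
      fix H assume "H \<in> pre_digraph.sccs (T \<restriction> X Core)"
      then have "verts H \<in> A.sccs_verts" unfolding A.sccs_verts_conv by (rule imageI)
      then obtain a where a: "a \<in> X Core" "verts H = A.scc_of a"
        unfolding A.sccs_verts_conv_scc_of by auto
      then obtain b where b: "b \<in> ?n a" "f b = Core" using core(2)[of a] by (auto simp: X_def)
      then have "a \<rightarrow>\<^bsub>T \<restriction> X Core\<^esub> b" using a(1) nE inV(1)[OF b(1)] by (auto simp: dominates_induce_iff X_def)
      then have "b \<in> A.scc_of a" using A.scc_ofI_reachable' by blast
      moreover have "a \<in> A.scc_of a" using A.in_scc_of_self a(1) by simp
      ultimately have sub: "{a, b} \<subseteq> verts H" using a(2) by simp
      have "a \<noteq> b" using b(1) E_irrefl a(1) XV by (auto simp: nbrs_def)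
      then have "card {a, b} = 2" by simp
      moreover have "finite (verts H)"
        using A.sccs_verts_subsets[OF \<open>verts H \<in> A.sccs_verts\<close>] A.finite_verts by (rule finite_subset)
      ultimately show "1 < card (verts H)" using card_mono[OF _ sub] by simp
    qed
    have c_attach: "leaf_attached T (X Core) (X Link)"
    proof -
      have "\<forall>a\<in>X Core. \<exists>b. b \<in> ?n a \<and> f b = Link \<and> (\<forall>y\<in>?n a. y \<noteq> b \<longrightarrow> f y = Core)"
        using core(1) by (auto simp: X_def)
      then obtain \<phi> where \<phi>: "\<And>a. a \<in> X Core \<Longrightarrow> \<phi> a \<in> ?n a \<and> f (\<phi> a) = Link \<and> (\<forall>y\<in>?n a. y \<noteq> \<phi> a \<longrightarrow> f y = Core)"
        by metis
      have \<phi>n: "\<phi> a \<in> ?n a" "a \<in> ?n (\<phi> a)" "\<phi> a \<in> X Link" if "a \<in> X Core" for a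
        using \<phi>[OF that] symn inV(1) by (auto simp: X_def)
      have \<phi>u: "y = \<phi> a" if "a \<in> X Core" "y \<in> X Link" "y \<in> ?n a" for a y
        using \<phi>[OF that(1)] that(2,3) by (auto simp: X_def)
      have lu: "a = a'" if b: "b \<in> X Link" "a \<in> X Core" "a' \<in> X Core" "a \<in> ?n b" "a' \<in> ?n b" for a a' b
      proof -
        obtain u v where "?n b = {u, v}" "f u = Core" "f v = Hub" using link[of b] b(1) by (auto simp: X_def)
        then show ?thesis using b by (auto simp: X_def)
      qed
      have "bij_betw \<phi> (X Core) (X Link)"
        unfolding bij_betw_def
      proof
        show "inj_on \<phi> (X Core)"
        proof (rule inj_onI)
          fix a a' assume a: "a \<in> X Core" "a' \<in> X Core" "\<phi> a = \<phi> a'"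
          then show "a = a'" using lu[OF \<phi>n(3)[OF a(1)] a(1,2) \<phi>n(2)[OF a(1)]] \<phi>n(2)[OF a(2)] by simp
        qed
        show "\<phi> ` X Core = X Link"
        proof
          show "\<phi> ` X Core \<subseteq> X Link" using \<phi>n(3) by blast
          show "X Link \<subseteq> \<phi> ` X Core"
          proof
            fix b assume b: "b \<in> X Link"
            then obtain a where a: "a \<in> ?n b" "f a = Core" using link[of b] by (auto simp: X_def)
            then have "a \<in> X Core" using inV(1) by (auto simp: X_def)
            then show "b \<in> \<phi> ` X Core" using \<phi>u[of a b] b symn[OF a(1)] by blast
          qed
        qed
      qed
      moreover have "arcs_ends (T \<restriction> (X Core \<union> X Link)) =
          arcs_ends (T \<restriction> X Core) \<union> {(a, \<phi> a) | a. a \<in> X Core} \<union> {(\<phi> a, a) | a. a \<in> X Core}" (is "?l = ?r")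
      proof (intro equalityI subrelI)
        fix u v assume "(u, v) \<in> ?l"
        then have uv: "u \<in> X Core \<union> X Link" "v \<in> X Core \<union> X Link" "u \<rightarrow>\<^bsub>T\<^esub> v"
          by (auto simp: dominates_induce_iff)
        then have n: "v \<in> ?n u" "u \<in> ?n v" using nE symn by blast+
        consider "u \<in> X Core" "v \<in> X Core" | "u \<in> X Core" "v \<in> X Link" | "u \<in> X Link" "v \<in> X Core"
          | "u \<in> X Link" "v \<in> X Link" using uv by blast
        then show "(u, v) \<in> ?r"
        proof cases
          case 1
          then show ?thesis using uv by (simp add: dominates_induce_iff)
        next
          case 2
          then show ?thesis using \<phi>u n by blast
        next
          case 3
          then show ?thesis using \<phi>u n by blast
        next
          case 4
          then show ?thesis using link[of u] n(1) by (auto simp: X_def)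
        qed
      next
        fix u v assume "(u, v) \<in> ?r"
        then consider "u \<rightarrow>\<^bsub>T \<restriction> X Core\<^esub> v" | "u \<in> X Core" "v = \<phi> u" | "v \<in> X Core" "u = \<phi> v" by blast
        then show "(u, v) \<in> ?l"
        proof cases
          case 1
          then show ?thesis by (simp add: dominates_induce_iff)
        next
          case 2
          then show ?thesis using \<phi>n[of u] nE[of v u] by (simp add: dominates_induce_iff)
        next
          case 3
          then show ?thesis using \<phi>n[of v] nE[of v u] by (simp add: dominates_induce_iff)
        qed
      qed
      ultimately show ?thesis unfolding leaf_attached_def by blast
    qed
    have c_link: "\<forall>u\<in>X Link. degree T u = 2 \<and> card (nbhd T u \<inter> X Core) = 1 \<and> card (nbhd T u \<inter> X Hub) = 1"
    proof
      fix u assume u: "u \<in> X Link"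
      then obtain a c where ac: "?n u = {a, c}" "f a = Core" "f c = Hub" using link[of u] by (auto simp: X_def)
      then have "a \<in> verts T" "c \<in> verts T" using inV(1)[of _ u] by auto
      then have "?n u \<inter> X Core = {a}" "?n u \<inter> X Hub = {c}" using ac by (auto simp: X_def)
      moreover have "a \<noteq> c" using ac by auto
      ultimately show "degree T u = 2 \<and> card (nbhd T u \<inter> X Core) = 1 \<and> card (nbhd T u \<inter> X Hub) = 1"
        by (simp add: degree_def nbhd_eq_nbrs ac(1))
    qed
    have c_hub: "\<forall>u\<in>X Hub. degree T u = k \<and> nbhd T u \<inter> X Link \<noteq> {} \<and> nbhd T u \<subseteq> X Link \<union> X Tip"
    proof
      fix u assume u: "u \<in> X Hub"
      then have u': "u \<in> verts T" "f u = Hub" by (auto simp: X_def)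
      have s: "?n u \<subseteq> X Link \<union> X Tip" using hub(2)[OF u'] inV(1) by (auto simp: X_def)
      obtain y where "y \<in> ?n u" "f y \<noteq> Tip" using False u' by blast
      then have "y \<in> ?n u \<inter> X Link" using s by (auto simp: X_def)
      then show "degree T u = k \<and> nbhd T u \<inter> X Link \<noteq> {} \<and> nbhd T u \<subseteq> X Link \<union> X Tip"
        using s hub(1)[OF u'] unfolding degree_def nbhd_eq_nbrs by blast
    qed
    let ?R = "X Core \<union> X Link \<union> X Hub"
    have RV: "?R \<subseteq> verts T" using XV by blast
    have "\<exists>r. r \<in> X Hub"
    proof -
      have hub_near: "\<exists>r. r \<in> X Hub" if x: "x \<in> verts T" "f x = Link \<or> f x = Tip" for x
      proof -
        obtain r where "r \<in> ?n x" "f r = Hub" using link[OF x(1)] tip[OF x(1)] x(2) by blast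
        then show ?thesis using inV(1) by (auto simp: X_def)
      qed
      obtain x where x: "x \<in> verts T"
        using strongly_connected_tree by (auto simp: strongly_connected_def)
      show ?thesis
      proof (cases "f x")
        case Core
        then obtain b where "b \<in> ?n x" "f b = Link" using core(1)[OF x] by blast
        then show ?thesis using hub_near inV(1) by blast
      qed (use hub_near x in \<open>auto simp: X_def\<close>)
    qed
    then obtain r where r: "r \<in> X Hub" by blast
    then have rV: "r \<in> verts T" using XV by blast
    obtain d :: "'a \<Rightarrow> nat" where par: "\<And>x. x \<in> verts T \<Longrightarrow> x \<noteq> r \<Longrightarrow> \<exists>y. x \<rightarrow>\<^bsub>T\<^esub> y \<and> d y < d x"
      using undirected_tree_ranking[OF tree rV] by blast
    have R: "graph (T \<restriction> ?R)" by (rule graph_induce[OF RV])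
    interpret R: graph "T \<restriction> ?R" by (rule R)
    have reach: "x \<rightarrow>\<^sup>*\<^bsub>T \<restriction> ?R\<^esub> r" if "x \<in> ?R" for x
      using that
    proof (induction "d x" arbitrary: x rule: less_induct)
      case less
      show ?case
      proof (cases "x = r")
        case True
        then show ?thesis using R.reachable_refl[of x] less.prems by simp
      next
        case False
        then obtain y where y: "x \<rightarrow>\<^bsub>T\<^esub> y" "d y < d x" using par less.prems RV by blast
        have yV: "y \<in> verts T" using adj_in_verts(2)[OF y(1)] .
        have "y \<notin> X Tip"
        proof
          assume yt: "y \<in> X Tip"
          then have "y \<noteq> r" using r by (auto simp: X_def)
          then obtain z where z: "y \<rightarrow>\<^bsub>T\<^esub> z" "d z < d y" using par yV by blast
          have "x \<in> ?n y" "z \<in> ?n y" using z(1) y(1) nE symn by blast+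
          then have "x = z" using tip[OF yV] yt by (auto simp: X_def)
          then show False using y(2) z(2) by simp
        qed
        then have yR: "y \<in> ?R" using yV V by blast
        then have "x \<rightarrow>\<^bsub>T \<restriction> ?R\<^esub> y" using less.prems y(1) by (simp add: dominates_induce_iff)
        then show ?thesis using less.hyps[OF y(2) yR] by (rule R.adj_reachable_trans)
      qed
    qed
    have "connected (T \<restriction> ?R)"
    proof (rule R.connectedI)
      show "verts (T \<restriction> ?R) \<noteq> {}" using r by auto
      fix u v assume "u \<in> verts (T \<restriction> ?R)" "v \<in> verts (T \<restriction> ?R)"
      then have "u \<rightarrow>\<^sup>*\<^bsub>T \<restriction> ?R\<^esub> r" "v \<rightarrow>\<^sup>*\<^bsub>T \<restriction> ?R\<^esub> r" using reach by auto
      then have "u \<rightarrow>\<^sup>*\<^bsub>T \<restriction> ?R\<^esub> v"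
        using symmetric_reachable[OF R.sym_arcs] R.reachable_trans by blast
      then show "u \<rightarrow>\<^sup>*\<^bsub>mk_symmetric (T \<restriction> ?R)\<^esub> v" by (rule R.reachable_mk_symmetricI)
    qed
    then have c_tree: "undirected_tree (T \<restriction> ?R)"
      using undirected_forest_induce[OF uf RV] by (simp add: undirected_tree_def)
    have "T \<in> family_T k"
      unfolding family_T_def mem_Collect_eq
      using tree V disj[of Core Link] disj[of Core Hub] disj[of Core Tip] disj[of Link Hub]
        disj[of Link Tip] disj[of Hub Tip] tips c_tip undirected_forest_induce[OF uf XV] c_comp
        c_attach c_link c_hub c_tree
      by (intro conjI exI[of _ "X Core"] exI[of _ "X Link"] exI[of _ "X Hub"] exI[of _ "X Tip"])
        (simp_all only: role.distinct not_False_eq_True simp_thms)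
    then show ?thesis by blast
  qed
qed

end

theorem theorem4p17:
  fixes T :: "('a, 'b) pre_digraph" and k :: nat
  assumes "2 \<le> k" and "undirected_tree T"
  shows "real (isolation_number k T) = real (card (verts T) + card (leaves T)) / real (2 * k + 1)
         \<longleftrightarrow> K\<^bsub>1,k\<^esub> T \<or> T \<in> family_T k"
proof -
  interpret isolation_tree T k using assms by unfold_locales
  have "real (isolation_number k T) = real (card (verts T) + card (leaves T)) / real (2 * k + 1)
      \<longleftrightarrow> real (2 * k + 1) * real (isolation_number k T) = real (card (verts T) + card (leaves T))"
    by (simp add: field_simps)
  also have "\<dots> \<longleftrightarrow> (2 * k + 1) * isolation_number k T = card (verts T) + card (leaves T)"
    by (metis of_nat_eq_iff of_nat_mult)
  also have "\<dots> \<longleftrightarrow> extremal (verts T)" by (rule isolation_number_eq_iff_extremal)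
  also have "\<dots> \<longleftrightarrow> K\<^bsub>1,k\<^esub> T \<or> T \<in> family_T k"
    using star_imp_extremal family_imp_extremal extremal_imp_star_or_family by blast
  finally show ?thesis .
qed

end
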